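(* Let $E$ be a complex Banach space, let $A$ be a commutative complex Banach algebra with identity $\mathbf{1}\neq 0$, and let $K\subset E$ be a compact set. Then $\mathbb{P}(K,A)$ is an admissible $A$-valued uniform algebra on $K$, and its subalgebra of scalar-valued functions is $\mathbb{P}(K,A)\cap \mathcal{C}(K)=\mathcal{P}_N(K)$.
   Context: $\mathcal{L}(E,A)$ is the space of bounded linear operators $E\to A$, and $E^*=\mathcal{L}(E,\mathbb{C})$. $\mathcal{C}(K,A)$ is the algebra of continuous functions $f:K\to A$ with norm $\|f\|_K=\sup_{x\in K}\|f(x)\|$, and $\mathcal{C}(K)=\mathcal{C}(K,\mathbb{C})$. The scalars $\mathbb{C}$ are identified with $\mathbb{C}\mathbf{1}\subset A$, so a scalar function $f\in\mathcal{C}(K)$ is identified with the $A$-valued function $x\mapsto f(x)\mathbf{1}$; in this way $\mathcal{C}(K)$ is regarded as a closed subalgebra of $\mathcal{C}(K,A)$. Elements $a\in A$ are identified with constant functions on $K$. An $A$-valued uniform algebra on $K$ is a closed subalgebra of $\mathcal{C}(K,A)$ that contains the constant functions (with values in $A$) and separates the points of $K$. A character of $A$ is a nonzero multiplicative linear functional $A\to\mathbb{C}$. An $A$-valued uniform algebra $\mathbf{A}$ is admissible if $\phi\circ f\in\mathbf{A}$ (where the scalar function $\phi\circ f\in\mathcal{C}(K)$ is identified with the $A$-valued function $x\mapsto \phi(f(x))\mathbf{1}$) for every $f\in\mathbf{A}$ and every character $\phi$ of $A$. For $n\ge 1$, $\mathbb{P}({}^nE,A)$ is the space of maps $P:E\to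 A$ of the form $P(x)=\sum_{i=1}^\infty T_i(x)^n$ with $T_i\in\mathcal{L}(E,A)$ and $\sum_{i=1}^\infty\|T_i\|^n<\infty$ (powers taken in the algebra $A$); $\mathbb{P}({}^0E,A)$ is the space of constant maps $E\to A$. $\mathbb{P}(E,A)$ is the space of all finite sums $P=P_0+P_1+\dots+P_n$ with $P_k\in\mathbb{P}({}^kE,A)$, $n\in\mathbb{N}$. $\mathbb{P}(K,A)$ is the closure in $\mathcal{C}(K,A)$ of $\{P|_K: P\in\mathbb{P}(E,A)\}$. Nuclear scalar polynomials are the case $A=\mathbb{C}$: $\mathcal{P}_N(E)=\mathbb{P}(E,\mathbb{C})$, and $\mathcal{P}_N(K)$ is the closure in $\mathcal{C}(K)$ of $\{P|_K:P\in\mathcal{P}_N(E)\}$. *)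

theory Defs
  imports "HOL-Analysis.Analysis"
begin

class complex_banach = banach +
  fixes scaleC :: "complex \<Rightarrow> 'a \<Rightarrow> 'a" (infixr "*\<^sub>C" 75)
  assumes scaleC_add_right: "c *\<^sub>C (x + y) = c *\<^sub>C x + c *\<^sub>C y"
    and scaleC_add_left: "(c + d) *\<^sub>C x = c *\<^sub>C x + d *\<^sub>C x"
    and scaleC_scaleC: "c *\<^sub>C d *\<^sub>C x = (c * d) *\<^sub>C x"
    and scaleC_of_real: "complex_of_real r *\<^sub>C x = r *\<^sub>R x"
    and norm_scaleC: "norm (c *\<^sub>C x) = cmod c * norm x"

(* The norm is submultiplicative and 1 \<noteq> 0 (from comm_ring_1), but norm 1 = 1 is not required. *)
class comm_complex_banach_algebra_1 = complex_banach + real_normed_algebra + comm_ring_1 +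
  assumes mult_scaleC_left: "(c *\<^sub>C x) * y = c *\<^sub>C (x * y)"

instantiation complex :: comm_complex_banach_algebra_1
begin

definition scaleC_complex :: "complex \<Rightarrow> complex \<Rightarrow> complex"
  where "scaleC_complex c x = c * x"

instance
  by standard (simp_all add: scaleC_complex_def algebra_simps norm_mult scaleR_conv_of_real)

end

definition bounded_clinear :: "('e::complex_banach \<Rightarrow> 'a::complex_banach) \<Rightarrow> bool"
  where "bounded_clinear T \<longleftrightarrow> bounded_linear T \<and> (\<forall>c x. T (c *\<^sub>C x) = c *\<^sub>C T x)"

definition is_character :: "('a::comm_complex_banach_algebra_1 \<Rightarrow> complex) \<Rightarrow> bool"
  where "is_character \<phi> \<longleftrightarrow>
    (\<forall>x y. \<phi> (x + y) = \<phi> x + \<phi> y) \<and>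
    (\<forall>c x. \<phi> (c *\<^sub>C x) = c * \<phi> x) \<and>
    (\<forall>x y. \<phi> (x * y) = \<phi> x * \<phi> y) \<and>
    (\<exists>x. \<phi> x \<noteq> 0)"

text \<open>
  Functions on \<open>K\<close> are represented by their extensional representatives (constantly
  \<open>undefined\<close> off \<open>K\<close>), and restriction to \<open>K\<close> is \<^const>\<open>restrict\<close>.
  The library space of bounded continuous functions, with the supremum distance, is then
  \<open>C(K,A)\<close>; the two lemmas below spell out its points and its distance.
\<close>

abbreviation cont_funs :: "'e::metric_space set \<Rightarrow> ('e \<Rightarrow> 'a::metric_space) metric"
  where "cont_funs K \<equiv> cfunspace (top_of_set K) euclidean_metric"

lemma mspace_cont_funs:
  assumes "compact K"
  shows "mspace (cont_funs K) = {f \<in> extensional K. continuous_on K f}"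
proof -
  have "Metric_space.mbounded UNIV dist (f ` K)" if "continuous_on K f" for f :: "'a \<Rightarrow> 'b"
    using compact_imp_bounded[OF compact_continuous_image[OF that assms]] by simp
  then show ?thesis
    by auto
qed

lemma mdist_cont_funs:
  fixes f g :: "'e::metric_space \<Rightarrow> 'a::real_normed_vector"
  assumes "compact K" "f \<in> mspace (cont_funs K)" "g \<in> mspace (cont_funs K)"
  shows "mdist (cont_funs K) f g = (if K = {} then 0 else SUP x\<in>K. norm (f x - g x))"
proof -
  have "f \<in> Met_TC.fspace K" "g \<in> Met_TC.fspace K"
    using assms by (auto simp: Met_TC.fspace_def)
  then show ?thesis
    by (simp add: mdist_cfunspace_eq_mdist_funspace Met_TC.fdist_def dist_norm)
qed

definition closed_subalgebra ::
    "'e::metric_space set \<Rightarrow> ('e \<Rightarrow> 'a::comm_complex_banach_algebra_1) set \<Rightarrow> bool"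
  where "closed_subalgebra K \<A> \<longleftrightarrow>
    closedin (mtopology_of (cont_funs K)) \<A> \<and>
    (\<lambda>x\<in>K. 0) \<in> \<A> \<and>
    (\<forall>f\<in>\<A>. \<forall>g\<in>\<A>. (\<lambda>x\<in>K. f x + g x) \<in> \<A>) \<and>
    (\<forall>c. \<forall>f\<in>\<A>. (\<lambda>x\<in>K. c *\<^sub>C f x) \<in> \<A>) \<and>
    (\<forall>f\<in>\<A>. \<forall>g\<in>\<A>. (\<lambda>x\<in>K. f x * g x) \<in> \<A>)"

definition uniform_algebra ::
    "'e::metric_space set \<Rightarrow> ('e \<Rightarrow> 'a::comm_complex_banach_algebra_1) set \<Rightarrow> bool"
  where "uniform_algebra K \<A> \<longleftrightarrow>
    closed_subalgebra K \<A> \<and>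
    (\<forall>a. (\<lambda>x\<in>K. a) \<in> \<A>) \<and>
    (\<forall>x\<in>K. \<forall>y\<in>K. x \<noteq> y \<longrightarrow> (\<exists>f\<in>\<A>. f x \<noteq> f y))"

text \<open>The identification of a scalar function \<open>f\<close> on \<open>K\<close> with \<open>x \<mapsto> f(x)1\<close>.\<close>

definition scalar_fun ::
    "'e set \<Rightarrow> ('e \<Rightarrow> complex) \<Rightarrow> 'e \<Rightarrow> 'a::comm_complex_banach_algebra_1"
  where "scalar_fun K f = (\<lambda>x\<in>K. f x *\<^sub>C 1)"

definition admissible ::
    "'e set \<Rightarrow> ('e \<Rightarrow> 'a::comm_complex_banach_algebra_1) set \<Rightarrow> bool"
  where "admissible K \<A> \<longleftrightarrow>
    (\<forall>f\<in>\<A>. \<forall>\<phi>. is_character \<phi> \<longrightarrow> scalar_fun K (\<phi> \<circ> f) \<in> \<A>)"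

definition hom_poly :: "nat \<Rightarrow> ('e::complex_banach \<Rightarrow> 'a::comm_complex_banach_algebra_1) set"
  where "hom_poly n =
    (if n = 0 then {P. \<exists>a. P = (\<lambda>x. a)}
     else {P. \<exists>T :: nat \<Rightarrow> 'e \<Rightarrow> 'a.
            (\<forall>i. bounded_clinear (T i)) \<and> summable (\<lambda>i. onorm (T i) ^ n) \<and>
            (\<forall>x. (\<lambda>i. T i x ^ n) sums P x)})"

definition polys :: "('e::complex_banach \<Rightarrow> 'a::comm_complex_banach_algebra_1) set"
  where "polys = {P. \<exists>n Q. (\<forall>k\<le>n. Q k \<in> hom_poly k) \<and> P = (\<lambda>x. \<Sum>k\<le>n. Q k x)}"

definition poly_algebra ::
    "'e::complex_banach set \<Rightarrow> ('e \<Rightarrow> 'a::comm_complex_banach_algebra_1) set"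
  where "poly_algebra K =
    mtopology_of (cont_funs K) closure_of ((\<lambda>P. restrict P K) ` polys)"

abbreviation nuclear_poly_algebra :: "'e::complex_banach set \<Rightarrow> ('e \<Rightarrow> complex) set"
  where "nuclear_poly_algebra K \<equiv> poly_algebra K"

end

theory Submission
  imports Defs "HOL-Complex_Analysis.Cauchy_Integral_Formula"
begin

text \<open>
  On the bounded set \<open>K\<close> the series defining a homogeneous polynomial converges uniformly, so
  \<open>\<P>(K,A)\<close> is the uniform closure of the polynomials of finite type, the finite sums of constants
  and powers of bounded linear maps.  By polarization these form an algebra, and the Hahn--Banach
  theorem supplies enough linear functionals to separate points.  A character \<open>\<phi>\<close> is automatically
  contractive and maps \<open>T(x)\<^sup>n\<close> to \<open>\<phi>(T(x))\<^sup>n\<close>; hence composition with \<open>\<phi>\<close> takes \<open>\<P>(K,A)\<close> to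
  \<open>\<P>\<^sub>N(K)\<close>, which gives admissibility.  Since \<open>A\<close> has a character (Gelfand--Mazur) and every
  character sends \<open>\<one>\<close> to 1, it also gives the description of the scalar-valued functions.
\<close>

text \<open>Recovering a scalar function \<open>h\<close> from \<open>h\<close> times the unit could
  be done with any functional \<open>l\<close> such that \<open>l 1 = 1\<close>, but
  \<open>l (T x ^ n)\<close> need not be a polynomial of finite type. Multiplicativity makes it a
  power of a single functional, which is why a character of the arbitrary algebra \<open>A\<close>
  has to be constructed. The norm of the unit may exceed 1, so power estimates start at exponent 1.
  Passing to finite type early avoids multiplying two infinite series.\<close>

section \<open>The Hahn--Banach theorem\<close>

text \<open>Homogeneity is demanded as an inequality for positive factors; applied to
  \<open>inverse c\<close> it becomes an equality.\<close>

definition sublinear :: "('a::real_vector \<Rightarrow> real) \<Rightarrow> bool"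
  where "sublinear q \<longleftrightarrow>
    (\<forall>x y. q (x + y) \<le> q x + q y) \<and> (\<forall>c>0. \<forall>x. q (c *\<^sub>R x) \<le> c * q x)"

lemma sublinear_add: "sublinear q \<Longrightarrow> q (x + y) \<le> q x + q y"
  by (simp add: sublinear_def)

lemma sublinear_scaleR:
  assumes "sublinear q" "c > 0"
  shows "q (c *\<^sub>R x) = c * q x"
proof (rule antisym)
  show "q (c *\<^sub>R x) \<le> c * q x"
    using assms by (simp add: sublinear_def)
  have "q (inverse c *\<^sub>R c *\<^sub>R x) \<le> inverse c * q (c *\<^sub>R x)"
    using assms unfolding sublinear_def by (metis inverse_positive_iff_positive)
  then show "c * q x \<le> q (c *\<^sub>R x)"
    using assms(2) by (simp add: field_simps)
qed

lemma sublinear_0: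
  assumes "sublinear q"
  shows "q 0 = 0"
  using sublinear_scaleR[OF assms, of 2 0] by simp

lemma sublinear_ge_minus:
  assumes "sublinear q"
  shows "- q (- x) \<le> q x"
  using sublinear_add[OF assms, of x "- x"] sublinear_0[OF assms] by simp

text \<open>Covers both infima taken below, over the parameter of a tilt and over a chain. The
  infima of the two summands use independent indices \<open>i\<close> and \<open>j\<close>, so a
  single \<open>k\<close> must serve for both.\<close>

lemma sublinear_INF:
  assumes "I \<noteq> {}"
    and bdd: "\<And>x. bdd_below ((\<lambda>i. Q i x) ` I)"
    and add: "\<And>i j x y. i \<in> I \<Longrightarrow> j \<in> I \<Longrightarrow> \<exists>k\<in>I. Q k (x + y) \<le> Q i x + Q j y"
    and scale: "\<And>i c x. i \<in> I \<Longrightarrow> c > 0 \<Longrightarrow> \<exists>k\<in>I. Q k (c *\<^sub>R x) \<le> c * Q i x"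
  shows "sublinear (\<lambda>x. INF i\<in>I. Q i x)"
  unfolding sublinear_def
proof (intro conjI allI impI)
  fix x y
  let ?c = "INF i\<in>I. Q i (x + y)"
  have 1: "?c - Q i x \<le> Q j y" if "i \<in> I" "j \<in> I" for i j
  proof -
    obtain k where "k \<in> I" "Q k (x + y) \<le> Q i x + Q j y"
      using add \<open>i \<in> I\<close> \<open>j \<in> I\<close> by blast
    then show ?thesis
      using cINF_lower[OF bdd, of k "x + y"] by linarith
  qed
  have 2: "?c - (INF j\<in>I. Q j y) \<le> Q i x" if "i \<in> I" for i
    using cINF_greatest[OF assms(1), of "?c - Q i x" "\<lambda>j. Q j y"] 1 that by force
  show "?c \<le> (INF i\<in>I. Q i x) + (INF j\<in>I. Q j y)"
    using cINF_greatest[OF assms(1), of "?c - (INF j\<in>I. Q j y)" "\<lambda>i. Q i x"] 2 by force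
next
  fix c :: real and x
  assume "c > 0"
  let ?d = "INF i\<in>I. Q i (c *\<^sub>R x)"
  have "?d / c \<le> Q i x" if "i \<in> I" for i
  proof -
    obtain k where "k \<in> I" "Q k (c *\<^sub>R x) \<le> c * Q i x"
      using scale \<open>i \<in> I\<close> \<open>c > 0\<close> by blast
    then show ?thesis
      using cINF_lower[OF bdd, of k "c *\<^sub>R x"] \<open>c > 0\<close> by (simp add: field_simps)
  qed
  then have "?d / c \<le> (INF i\<in>I. Q i x)"
    by (intro cINF_greatest assms(1))
  then show "?d \<le> c * (INF i\<in>I. Q i x)"
    using \<open>c > 0\<close> by (simp add: field_simps)
qed

text \<open>
  Lowering \<open>q\<close> in the direction \<open>v\<close>: every linear functional below the result takes the
  value \<open>q v\<close> at \<open>v\<close>, and if \<open>q\<close> is minimal, so that it is not lowered, then it is additive.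
\<close>

lemma sublinear_tilt:
  assumes q: "sublinear q"
  shows "\<exists>r. sublinear r \<and> (\<forall>x. r x \<le> q x) \<and> (\<forall>x. r x \<le> q (x + v) - q v)"
proof -
  \<comment> \<open>The parameter \<open>t = 0\<close> gives the first bound and
    \<open>t = 1\<close> the second; ranging over all \<open>t \<ge> 0\<close> makes the infimum
    sublinear, since parameters can be added and scaled.\<close>
  let ?Q = "\<lambda>t x. q (x + t *\<^sub>R v) - t * q v"
  let ?r = "\<lambda>x. INF t\<in>{0..}. ?Q t x"
  have tq: "t * q v = q (t *\<^sub>R v)" if "t \<ge> 0" for t
    using that sublinear_scaleR[OF q, of t v] sublinear_0[OF q] by (cases "t = 0") auto
  have bdd: "bdd_below ((\<lambda>t. ?Q t x) ` {0..})" for x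
  proof (rule bdd_belowI2)
    fix t :: real assume "t \<in> {0..}"
    then show "- q (- x) \<le> ?Q t x"
      using sublinear_add[OF q, of "x + t *\<^sub>R v" "- x"] by (simp add: tq)
  qed
  have "sublinear ?r"
  proof (rule sublinear_INF[OF _ bdd])
    show "{0::real..} \<noteq> {}" by auto
    show "\<exists>k\<in>{0..}. ?Q k (x + y) \<le> ?Q i x + ?Q j y" if "i \<in> {0..}" "j \<in> {0..}" for i j x y
      using that sublinear_add[OF q, of "x + i *\<^sub>R v" "y + j *\<^sub>R v"]
      by (intro bexI[of _ "i + j"]) (auto simp: algebra_simps)
    show "\<exists>k\<in>{0..}. ?Q k (c *\<^sub>R x) \<le> c * ?Q i x" if "i \<in> {0..}" "c > 0" for i c x
      using that sublinear_scaleR[OF q \<open>c > 0\<close>, of "x + i *\<^sub>R v"]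
      by (intro bexI[of _ "c * i"]) (auto simp: algebra_simps)
  qed
  moreover have "?r x \<le> q x" for x
    using cINF_lower[OF bdd, of 0 x] by simp
  moreover have "?r x \<le> q (x + v) - q v" for x
    using cINF_lower[OF bdd, of 1 x] by simp
  ultimately show ?thesis by blast
qed

text \<open>Zorn's lemma downwards. The pointwise infimum of a chain is finite because each member
  satisfies \<open>q x \<ge> - q (- x) \<ge> - p (- x)\<close>, and sublinear because of two members
  one lies below the other.\<close>

lemma minimal_sublinear_exists:
  assumes p: "sublinear p"
  shows "\<exists>m. sublinear m \<and> (\<forall>x. m x \<le> p x) \<and> (\<forall>q. sublinear q \<longrightarrow> (\<forall>x. q x \<le> m x) \<longrightarrow> q = m)"
proof -
  let ?A = "{q. sublinear q \<and> q \<le> p}"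
  let ?R = "relation_of (\<lambda>q r :: 'a \<Rightarrow> real. r \<le> q) ?A"
  have "\<exists>m\<in>?A. \<forall>a\<in>?A. a \<le> m \<longrightarrow> a = m"
  proof (rule predicate_Zorn)
    show "partial_order_on ?A ?R"
      by (rule partial_order_on_relation_ofI) auto
  next
    fix C assume C: "C \<in> Chains ?R"
    then have CA: "C \<subseteq> ?A" and total: "\<And>q r. q \<in> C \<Longrightarrow> r \<in> C \<Longrightarrow> q \<le> r \<or> r \<le> q"
      by (auto simp: Chains_def relation_of_def)
    show "\<exists>u\<in>?A. \<forall>a\<in>C. u \<le> a"
    proof (cases "C = {}")
      case True
      then show ?thesis using p by auto
    next
      case False
      let ?u = "\<lambda>x. INF q\<in>C. q x"
      have bdd: "bdd_below ((\<lambda>q. q x) ` C)" for x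
      proof (rule bdd_belowI2)
        fix q assume "q \<in> C"
        then have "sublinear q" "q (- x) \<le> p (- x)"
          using CA by (auto simp: le_fun_def)
        then show "- p (- x) \<le> q x"
          using sublinear_ge_minus[of q x] by linarith
      qed
      have "sublinear ?u"
      proof (rule sublinear_INF[OF False bdd])
        fix q r x y assume qr: "q \<in> C" "r \<in> C"
        then have sub: "sublinear q" "sublinear r" using CA by auto
        show "\<exists>k\<in>C. k (x + y) \<le> q x + r y"
          using total[OF qr]
        proof
          assume "q \<le> r"
          then have "q (x + y) \<le> q x + r y"
            using sublinear_add[OF sub(1), of x y] by (auto simp: le_fun_def intro: order_trans)
          then show ?thesis using qr by blast
        next
          assume "r \<le> q"
          then have "r (x + y) \<le> q x + r y"
            using sublinear_add[OF sub(2), of x y] by (auto simp: le_fun_def intro: order_trans)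
          then show ?thesis using qr by blast
        qed
      next
        fix q x and c :: real assume "q \<in> C" "c > 0"
        then show "\<exists>k\<in>C. k (c *\<^sub>R x) \<le> c * q x"
          using CA by (intro bexI[of _ q]) (auto simp: sublinear_def)
      qed
      moreover have below: "?u \<le> q" if "q \<in> C" for q
        using cINF_lower[OF bdd that] by (simp add: le_fun_def)
      moreover have "?u \<le> p"
        using False below CA by (auto intro: order_trans)
      ultimately show ?thesis by blast
    qed
  qed
  then obtain m where m: "sublinear m" "m \<le> p"
    and minimal: "\<And>q. sublinear q \<Longrightarrow> q \<le> p \<Longrightarrow> q \<le> m \<Longrightarrow> q = m"
    by blast
  have "q = m" if "sublinear q" "\<forall>x. q x \<le> m x" for q
  proof (rule minimal)
    show "q \<le> m" using that by (simp add: le_fun_def)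
    then show "q \<le> p" using m(2) by (rule order_trans)
  qed (rule that)
  with m show ?thesis
    unfolding le_fun_def by blast
qed

text \<open>Tilting \<open>p\<close> along \<open>v\<close> before minimizing fixes the value at
  \<open>v\<close>; minimality gives linearity, because a further tilt cannot lower
  \<open>f\<close>.\<close>

theorem real_hahn_banach:
  assumes p: "sublinear p"
  shows "\<exists>f. linear f \<and> (\<forall>x. f x \<le> p x) \<and> f v = p v"
proof -
  obtain r where r: "sublinear r" "\<And>x. r x \<le> p x" "\<And>x. r x \<le> p (x + v) - p v"
    using sublinear_tilt[OF p, of v] by blast
  obtain f where f: "sublinear f" "\<And>x. f x \<le> r x"
    and minimal: "\<And>q. sublinear q \<Longrightarrow> (\<And>x. q x \<le> f x) \<Longrightarrow> q = f"
    using minimal_sublinear_exists[OF r(1)] by blast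
  have add: "f (x + y) = f x + f y" for x y
  proof -
    obtain q where q: "sublinear q" "\<And>x. q x \<le> f x" "\<And>x. q x \<le> f (x + y) - f y"
      using sublinear_tilt[OF f(1), of y] by blast
    \<comment> \<open>As the tilt leaves \<open>f\<close> unchanged, its second bound reads
      \<open>f x \<le> f (x + y) - f y\<close>, the missing superadditivity.\<close>
    then have "q = f" by (intro minimal)
    then show ?thesis
      using q(3)[of x] sublinear_add[OF f(1), of x y] by simp
  qed
  have minus: "f (- x) = - f x" for x
    using add[of x "- x"] sublinear_0[OF f(1)] by simp
  have "f (c *\<^sub>R x) = c * f x" for c x
  proof (cases c "0::real" rule: linorder_cases)
    case less
    then show ?thesis
      using sublinear_scaleR[OF f(1), of "- c" x] minus[of "c *\<^sub>R x"] by simp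
  next
    case equal
    then show ?thesis using sublinear_0[OF f(1)] by simp
  next
    case greater
    then show ?thesis by (rule sublinear_scaleR[OF f(1)])
  qed
  then have "linear f"
    using add by (intro linearI) auto
  moreover have le: "f x \<le> p x" for x
    using f(2) r(2) order_trans by blast
  \<comment> \<open>At \<open>- v\<close> the tilt bound is \<open>f (- v) \<le> p 0 - p v\<close>,
    hence \<open>f v \<ge> p v\<close>.\<close>
  moreover have "f v = p v"
    using f(2)[of "- v"] r(3)[of "- v"] minus[of v] sublinear_0[OF p] le[of v] by simp
  ultimately show ?thesis by blast
qed

section \<open>Complex scalar multiplication\<close>

lemma scaleC_one [simp]: "1 *\<^sub>C x = (x::'a::complex_banach)"
  using scaleC_of_real[of 1 x] by simp

lemma scaleC_zero_left [simp]: "0 *\<^sub>C x = (0::'a::complex_banach)"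
  using scaleC_of_real[of 0 x] by simp

lemma scaleC_minus_one: "(- 1) *\<^sub>C x = - (x::'a::complex_banach)"
  using scaleC_of_real[of "- 1" x] by simp

lemma scaleC_minus_left: "(- c) *\<^sub>C x = - (c *\<^sub>C (x::'a::complex_banach))"
  by (metis mult_minus1 scaleC_minus_one scaleC_scaleC)

lemma scaleC_minus_right: "c *\<^sub>C (- x) = - (c *\<^sub>C (x::'a::complex_banach))"
  by (metis mult.commute scaleC_minus_one scaleC_scaleC)

lemma scaleC_diff_left: "(c - d) *\<^sub>C x = c *\<^sub>C x - d *\<^sub>C (x::'a::complex_banach)"
  using scaleC_add_left[of c "- d" x] by (simp add: scaleC_minus_left)

lemma scaleC_diff_right: "c *\<^sub>C (x - y) = c *\<^sub>C x - c *\<^sub>C (y::'a::complex_banach)"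
  using scaleC_add_right[of c x "- y"] by (simp add: scaleC_minus_right)

lemma scaleC_scaleR: "c *\<^sub>C r *\<^sub>R x = r *\<^sub>R c *\<^sub>C (x::'a::complex_banach)"
  by (metis mult.commute scaleC_of_real scaleC_scaleC)

lemma scaleC_zero_right [simp]: "c *\<^sub>C 0 = (0::'a::complex_banach)"
  using scaleC_scaleR[of c 0 0] by simp

lemma scaleC_one_mult: "(c *\<^sub>C 1) * x = c *\<^sub>C (x::'a::comm_complex_banach_algebra_1)"
  by (simp add: mult_scaleC_left)

lemma mult_scaleC_right: "x * (c *\<^sub>C y) = c *\<^sub>C (x * (y::'a::comm_complex_banach_algebra_1))"
  by (metis mult.commute mult_scaleC_left)

lemma scaleC_power: "(c *\<^sub>C x) ^ n = c ^ n *\<^sub>C ((x::'a::comm_complex_banach_algebra_1) ^ n)"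
  by (induction n) (simp_all add: mult_scaleC_left mult_scaleC_right scaleC_scaleC mult.commute)

text \<open>
  The algebras at hand are not of class \<open>real_algebra_1\<close>, so that \<open>scaleR_power\<close> and
  \<open>scaleR_conv_of_real\<close> are not available.
\<close>

lemma algebra_scaleR_power:
  "(r *\<^sub>R x) ^ n = r ^ n *\<^sub>R ((x::'a::comm_complex_banach_algebra_1) ^ n)"
  using scaleC_power[of "complex_of_real r" x n] by (simp add: scaleC_of_real flip: of_real_power)

lemma of_nat_mult_eq_scaleR:
  "of_nat n * x = real n *\<^sub>R (x::'a::comm_complex_banach_algebra_1)"
  by (induction n) (simp_all add: algebra_simps)

lemma norm_power_Suc_le: "norm ((x::'a::comm_complex_banach_algebra_1) ^ Suc n) \<le> norm x ^ Suc n"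
proof (induction n)
  case (Suc n)
  have "norm (x ^ Suc (Suc n)) \<le> norm x * norm (x ^ Suc n)"
    using norm_mult_ineq[of x "x ^ Suc n"] by simp
  also have "\<dots> \<le> norm x * norm x ^ Suc n"
    using Suc by (intro mult_left_mono) auto
  finally show ?case by simp
qed simp

text \<open>A complex-linear functional is determined by its real part \<open>f\<close>, as
  \<open>f x - \<i> * f (\<i> *\<^sub>C x)\<close>. The factor 2 comes from bounding the modulus by
  the sum of the absolute real and imaginary parts; any constant would serve below.\<close>

theorem complex_hahn_banach:
  fixes p :: "'a::complex_banach \<Rightarrow> real"
  assumes add: "\<And>x y. p (x + y) \<le> p x + p y" and scale: "\<And>c x. p (c *\<^sub>C x) = cmod c * p x"
  shows "\<exists>l. linear l \<and> (\<forall>c x. l (c *\<^sub>C x) = c * l x) \<and> (\<forall>x. cmod (l x) \<le> 2 * p x) \<and> Re (l v) = p v"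
proof -
  have "sublinear p"
    unfolding sublinear_def
  proof (intro conjI allI impI)
    show "p (c *\<^sub>R x) \<le> c * p x" if "c > 0" for c x
      using that scale[of "complex_of_real c" x] by (simp add: scaleC_of_real)
  qed (rule add)
  from real_hahn_banach[OF this, of v] obtain f
    where f: "linear f" "\<And>x. f x \<le> p x" "f v = p v" by blast
  have f_add: "f (x + y) = f x + f y" and f_scale: "f (r *\<^sub>R x) = r * f x" for x y r
    using f(1) by (simp_all add: linear_add linear_scale)
  have abs_f: "\<bar>f x\<bar> \<le> p x" for x
    using f(2)[of x] f(2)[of "- x"] linear_neg[OF f(1), of x] scale[of "- 1" x]
    by (simp add: scaleC_minus_one)
  define l where "l x = Complex (f x) (- f (\<i> *\<^sub>C x))" for x
  have "linear l"
    by (rule linearI)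
      (simp_all add: l_def f_add f_scale scaleC_add_right scaleC_scaleR complex_eq_iff)
  moreover have "l (c *\<^sub>C x) = c * l x" for c x
  proof -
    have c: "c *\<^sub>C y = Re c *\<^sub>R y + Im c *\<^sub>R \<i> *\<^sub>C y" for y :: 'a
    proof -
      have "c *\<^sub>C y = (complex_of_real (Re c) + complex_of_real (Im c) * \<i>) *\<^sub>C y"
        by (metis complex_eq mult.commute)
      also have "\<dots> = Re c *\<^sub>R y + Im c *\<^sub>R \<i> *\<^sub>C y"
        by (simp only: scaleC_add_left scaleC_scaleC[symmetric] scaleC_of_real)
      finally show ?thesis .
    qed
    have "\<i> *\<^sub>C \<i> *\<^sub>C x = - x"
      by (simp add: scaleC_scaleC scaleC_minus_one)
    then have "f (\<i> *\<^sub>C c *\<^sub>C x) = Re c * f (\<i> *\<^sub>C x) - Im c * f x"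
      by (subst c) (simp add: scaleC_add_right scaleC_scaleR f_add f_scale linear_diff[OF f(1)])
    moreover have "f (c *\<^sub>C x) = Re c * f x + Im c * f (\<i> *\<^sub>C x)"
      by (subst c) (simp add: f_add f_scale)
    ultimately show ?thesis
      by (simp add: l_def complex_eq_iff)
  qed
  moreover have "cmod (l x) \<le> 2 * p x" for x
    using cmod_le[of "l x"] abs_f[of x] abs_f[of "\<i> *\<^sub>C x"] scale[of \<i> x] by (simp add: l_def)
  moreover have "Re (l v) = p v"
    using f(3) by (simp add: l_def)
  ultimately show ?thesis by blast
qed

section \<open>Characters\<close>

text \<open>\<open>s\<close> is the Neumann series without its constant term, so
  \<open>1 + s\<close> inverts \<open>1 - u\<close>. Starting at the first power keeps
  \<open>norm 1\<close> out of the estimate.\<close>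

lemma quasi_inverse_exists:
  fixes u :: "'a::comm_complex_banach_algebra_1"
  assumes "norm u < 1"
  shows "\<exists>s. s = u + u * s"
proof -
  have "summable (\<lambda>n. norm u ^ Suc n)"
    using assms by (simp only: summable_Suc_iff) (simp add: summable_geometric)
  then have s: "summable (\<lambda>n. u ^ Suc n)"
    by (rule summable_comparison_test') (rule norm_power_Suc_le)
  have "(\<Sum>n. u ^ Suc n) = u + (\<Sum>n. u ^ Suc (Suc n))"
    using suminf_split_head[OF s] by simp
  also have "(\<Sum>n. u ^ Suc (Suc n)) = u * (\<Sum>n. u ^ Suc n)"
    using suminf_mult[OF s, of u] by simp
  finally show ?thesis by blast
qed

lemma character_one:
  assumes "is_character \<phi>"
  shows "\<phi> 1 = 1"
  using assms unfolding is_character_def by (metis mult_cancel_right1 mult_1)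

text \<open>Otherwise a multiple \<open>u\<close> of \<open>a\<close> has norm below 1 and
  \<open>\<phi> u = 1\<close>; applying \<open>\<phi>\<close> to \<open>s = u + u * s\<close> then
  yields \<open>\<phi> s = 1 + \<phi> s\<close>.\<close>

lemma norm_character_le:
  assumes \<phi>: "is_character \<phi>"
  shows "cmod (\<phi> a) \<le> norm a"
proof (rule ccontr)
  assume "\<not> ?thesis"
  then have less: "norm a < cmod (\<phi> a)" by simp
  then have "\<phi> a \<noteq> 0" by auto
  define u where "u = (1 / \<phi> a) *\<^sub>C a"
  have "norm u < 1"
    using less \<open>\<phi> a \<noteq> 0\<close> by (simp add: u_def norm_scaleC norm_divide)
  then obtain s where "s = u + u * s"
    using quasi_inverse_exists by blast
  then have "\<phi> s = \<phi> u + \<phi> u * \<phi> s"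
    using \<phi> unfolding is_character_def by metis
  moreover have "\<phi> u = 1"
    using \<phi> \<open>\<phi> a \<noteq> 0\<close> by (simp add: is_character_def u_def)
  ultimately show False by simp
qed

lemma character_diff:
  assumes "is_character \<phi>"
  shows "\<phi> (x - y) = \<phi> x - \<phi> y"
  using assms unfolding is_character_def by (metis add_diff_cancel_right' diff_add_cancel)

section \<open>Maximal ideals\<close>

definition proper_ideal :: "'a::comm_ring_1 set \<Rightarrow> bool"
  where "proper_ideal M \<longleftrightarrow>
    0 \<in> M \<and> (\<forall>x\<in>M. \<forall>y\<in>M. x + y \<in> M) \<and> (\<forall>a. \<forall>x\<in>M. a * x \<in> M) \<and> 1 \<notin> M"

lemma proper_idealD:
  assumes "proper_ideal M"
  shows "0 \<in> M" "\<And>x y. x \<in> M \<Longrightarrow> y \<in> M \<Longrightarrow> x + y \<in> M" "\<And>a x. x \<in> M \<Longrightarrow> a * x \<in> M" "1 \<notin> M"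
    "\<And>x. x \<in> M \<Longrightarrow> - x \<in> M" "\<And>x y. x \<in> M \<Longrightarrow> y \<in> M \<Longrightarrow> x - y \<in> M"
proof -
  show *: "0 \<in> M" "\<And>x y. x \<in> M \<Longrightarrow> y \<in> M \<Longrightarrow> x + y \<in> M" "\<And>a x. x \<in> M \<Longrightarrow> a * x \<in> M" "1 \<notin> M"
    using assms by (auto simp: proper_ideal_def)
  show m: "- x \<in> M" if "x \<in> M" for x
    using *(3)[OF that, of "- 1"] by simp
  show "x - y \<in> M" if "x \<in> M" "y \<in> M" for x y
    using *(2)[OF that(1) m[OF that(2)]] by simp
qed

text \<open>Maximality is recorded as invertibility modulo \<open>M\<close>, the form used later. It
  comes from the ideal \<open>M + A b\<close>, which is strictly larger than \<open>M\<close> and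
  hence contains 1.\<close>

lemma maximal_ideal_exists:
  "\<exists>M :: 'a::comm_ring_1 set. proper_ideal M \<and> (\<forall>b. b \<notin> M \<longrightarrow> (\<exists>c. c * b - 1 \<in> M))"
proof -
  have "\<exists>M\<in>Collect proper_ideal. \<forall>X\<in>Collect proper_ideal. M \<subseteq> X \<longrightarrow> X = (M :: 'a set)"
  proof (rule subset_Zorn_nonempty)
    have "proper_ideal {0::'a}" by (simp add: proper_ideal_def)
    then show "Collect proper_ideal \<noteq> ({} :: 'a set set)" by blast
  next
    fix \<C> :: "'a set set"
    assume "\<C> \<noteq> {}" and chain: "subset.chain (Collect proper_ideal) \<C>"
    have ideal: "proper_ideal X" if "X \<in> \<C>" for X
      using chain that by (auto simp: subset.chain_def)
    have "x + y \<in> \<Union>\<C>" if "x \<in> X" "X \<in> \<C>" "y \<in> Y" "Y \<in> \<C>" for x y X Y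
    proof -
      have "X \<subseteq> Y \<or> Y \<subseteq> X"
        using chain that by (auto simp: subset.chain_def)
      then show ?thesis
        using that proper_idealD(2)[OF ideal] by blast
    qed
    moreover have "0 \<in> \<Union>\<C>"
      using \<open>\<C> \<noteq> {}\<close> proper_idealD(1)[OF ideal] by blast
    moreover have "a * x \<in> \<Union>\<C>" if "x \<in> \<Union>\<C>" for a x
      using that proper_idealD(3)[OF ideal] by blast
    moreover have "1 \<notin> \<Union>\<C>"
      using proper_idealD(4)[OF ideal] by blast
    ultimately show "\<Union>\<C> \<in> Collect proper_ideal"
      unfolding proper_ideal_def by blast
  qed
  then obtain M :: "'a set" where M: "proper_ideal M"
    and maximal: "\<And>X. proper_ideal X \<Longrightarrow> M \<subseteq> X \<Longrightarrow> X = M"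
    by blast
  have "\<exists>c. c * b - 1 \<in> M" if "b \<notin> M" for b
  proof -
    define X where "X = {m + c * b |m c. m \<in> M}"
    have "M \<subseteq> X"
      unfolding X_def by (clarsimp, metis add.right_neutral mult_zero_left)
    moreover have "b \<in> X"
      unfolding X_def using proper_idealD(1)[OF M] by (clarsimp, metis add.left_neutral mult_1)
    ultimately have "\<not> proper_ideal X"
      using maximal \<open>b \<notin> M\<close> by blast
    moreover have "0 \<in> X"
      using proper_idealD(1)[OF M] \<open>M \<subseteq> X\<close> by blast
    moreover have "x + y \<in> X" if "x \<in> X" "y \<in> X" for x y
    proof -
      obtain m c n d where "x = m + c * b" "y = n + d * b" "m \<in> M" "n \<in> M"
        using \<open>x \<in> X\<close> \<open>y \<in> X\<close> by (auto simp: X_def)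
      then have "x + y = (m + n) + (c + d) * b" "m + n \<in> M"
        using proper_idealD(2)[OF M \<open>m \<in> M\<close> \<open>n \<in> M\<close>] by (simp_all add: algebra_simps)
      then show ?thesis unfolding X_def by blast
    qed
    moreover have "a * x \<in> X" if "x \<in> X" for a x
    proof -
      obtain m c where "x = m + c * b" "m \<in> M"
        using \<open>x \<in> X\<close> by (auto simp: X_def)
      then have "a * x = a * m + (a * c) * b" "a * m \<in> M"
        using proper_idealD(3)[OF M \<open>m \<in> M\<close>] by (simp_all add: algebra_simps)
      then show ?thesis unfolding X_def by blast
    qed
    ultimately have "1 \<in> X"
      by (auto simp: proper_ideal_def)
    then obtain m c where "1 = m + c * b" "m \<in> M"
      by (auto simp: X_def)
    then have "c * b - 1 = - m"
      by (simp add: algebra_simps)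
    then show ?thesis
      using proper_idealD(5)[OF M \<open>m \<in> M\<close>] by metis
  qed
  with M show ?thesis by blast
qed

section \<open>The quotient seminorm of an ideal\<close>

lemma proper_ideal_scaleC:
  fixes M :: "'a::comm_complex_banach_algebra_1 set"
  assumes "proper_ideal M" "x \<in> M"
  shows "c *\<^sub>C x \<in> M"
  using proper_idealD(3)[OF assms, of "c *\<^sub>C 1"] by (simp add: scaleC_one_mult)

lemma infdist_less:
  assumes "M \<noteq> {}" "infdist x M < r"
  shows "\<exists>m\<in>M. dist x m < r"
  using assms by (simp add: infdist_notempty cINF_less_iff)

text \<open>This is the quotient norm of \<open>A / M\<close> pulled back to \<open>A\<close>. It is
  positive at 1 because elements at distance below 1 from the unit are invertible, so none of them
  lies in \<open>M\<close>.\<close>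

lemma infdist_ideal:
  fixes M :: "'a::comm_complex_banach_algebra_1 set"
  assumes M: "proper_ideal M"
  shows infdist_ideal_add: "infdist (x + y) M \<le> infdist x M + infdist y M"
    and infdist_ideal_mult: "infdist (x * y) M \<le> infdist x M * infdist y M"
    and infdist_ideal_scaleC: "infdist (c *\<^sub>C x) M = cmod c * infdist x M"
    and infdist_ideal_one: "infdist 1 M > 0"
proof -
  note I = proper_idealD[OF M]
  have ne: "M \<noteq> {}" using I(1) by blast
  show "infdist (x + y) M \<le> infdist x M + infdist y M"
  proof (rule field_le_epsilon)
    fix e :: real assume "e > 0"
    then obtain m n where mn: "m \<in> M" "n \<in> M" "dist x m < infdist x M + e / 2" "dist y n < infdist y M + e / 2"
      using infdist_less[OF ne, of x "infdist x M + e / 2"]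
        infdist_less[OF ne, of y "infdist y M + e / 2"] by auto
    have "infdist (x + y) M \<le> dist (x + y) (m + n)"
      using mn I(2) by (intro infdist_le) auto
    also have "\<dots> \<le> dist x m + dist y n"
      by (rule dist_triangle_add)
    finally show "infdist (x + y) M \<le> infdist x M + infdist y M + e"
      using mn by linarith
  qed
  show "infdist (x * y) M \<le> infdist x M * infdist y M"
  proof (rule tendsto_lowerbound)
    show "((\<lambda>e. (infdist x M + e) * (infdist y M + e)) \<longlongrightarrow> infdist x M * infdist y M) (at_right 0)"
      by (auto intro!: tendsto_eq_intros)
    show "\<forall>\<^sub>F e in at_right 0. infdist (x * y) M \<le> (infdist x M + e) * (infdist y M + e)"
      using eventually_at_right_less[of "0::real"]
    proof eventually_elim
      fix e :: real assume "0 < e"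
      then obtain m n where mn: "m \<in> M" "n \<in> M" "dist x m < infdist x M + e" "dist y n < infdist y M + e"
        using infdist_less[OF ne, of x "infdist x M + e"]
          infdist_less[OF ne, of y "infdist y M + e"] by auto
      \<comment> \<open>Modulo \<open>M\<close> the product \<open>(x - m) * (y - n)\<close> equals
        \<open>x * y\<close>, so its norm bounds the distance of \<open>x * y\<close> from
        \<open>M\<close>.\<close>
      have eq: "(x - m) * (y - n) = x * y - (x * n + (y - n) * m)"
        by (simp add: algebra_simps)
      have "infdist (x * y) M \<le> dist (x * y) (x * n + (y - n) * m)"
        using mn I by (intro infdist_le) auto
      also have "\<dots> \<le> dist x m * dist y n"
        unfolding dist_norm eq[symmetric] by (rule norm_mult_ineq)
      also have "\<dots> \<le> (infdist x M + e) * (infdist y M + e)"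
        using mn \<open>0 < e\<close> by (intro mult_mono) (auto simp: infdist_nonneg add_nonneg_nonneg)
      finally show "infdist (x * y) M \<le> (infdist x M + e) * (infdist y M + e)" .
    qed
  qed simp
  have scale_le: "infdist (d *\<^sub>C y) M \<le> cmod d * infdist y M" if "d \<noteq> 0" for d y
  proof -
    have "infdist (d *\<^sub>C y) M / cmod d \<le> dist y m" if "m \<in> M" for m
    proof -
      have "infdist (d *\<^sub>C y) M \<le> dist (d *\<^sub>C y) (d *\<^sub>C m)"
        using proper_ideal_scaleC[OF M that] by (rule infdist_le)
      also have "\<dots> = cmod d * dist y m"
        by (simp add: dist_norm norm_scaleC flip: scaleC_diff_right)
      finally show ?thesis
        using \<open>d \<noteq> 0\<close> by (simp add: field_simps)
    qed
    then have "infdist (d *\<^sub>C y) M / cmod d \<le> infdist y M"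
      using ne by (auto simp: infdist_notempty intro!: cINF_greatest)
    then show ?thesis
      using \<open>d \<noteq> 0\<close> by (simp add: field_simps)
  qed
  show "infdist (c *\<^sub>C x) M = cmod c * infdist x M"
  proof (cases "c = 0")
    case True
    then show ?thesis using I(1) by simp
  next
    case False
    \<comment> \<open>Scaling back by \<open>inverse c\<close> turns \<open>scale_le\<close> into
      the reverse inequality.\<close>
    have "infdist (inverse c *\<^sub>C c *\<^sub>C x) M \<le> cmod (inverse c) * infdist (c *\<^sub>C x) M"
      using False by (intro scale_le) auto
    then have "cmod c * infdist x M \<le> infdist (c *\<^sub>C x) M"
      using False by (simp add: scaleC_scaleC norm_divide field_simps)
    then show ?thesis
      using scale_le[OF False, of x] by simp
  qed
  have "1 \<le> dist 1 m" if "m \<in> M" for m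
  proof (rule ccontr)
    assume "\<not> ?thesis"
    then obtain s where "s = (1 - m) + (1 - m) * s"
      using quasi_inverse_exists[of "1 - m"] by (auto simp: dist_norm)
    then have "1 = (1 + s) * m"
      by (simp add: algebra_simps)
    then show False
      using I(3)[OF that, of "1 + s"] I(4) by simp
  qed
  then have "1 \<le> infdist 1 M"
    using ne by (auto simp: infdist_notempty intro!: cINF_greatest)
  then show "infdist 1 M > 0" by simp
qed

text \<open>
  Gelfand--Mazur, phrased with a maximal ideal \<open>M\<close> instead of the quotient field: if every
  \<open>a - z1\<close> had an inverse \<open>b z\<close> modulo \<open>M\<close>, then for a functional \<open>l\<close> vanishing on \<open>M\<close> with
  \<open>l 1 \<noteq> 0\<close> the function \<open>l (b z)\<close> would be entire and vanish at infinity, hence be zero, which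
  contradicts that \<open>z * l (b z)\<close> tends to \<open>- l 1\<close>.
\<close>

lemma maximal_ideal_residue:
  fixes M :: "'a::comm_complex_banach_algebra_1 set"
  assumes M: "proper_ideal M" and maximal: "\<And>b. b \<notin> M \<Longrightarrow> \<exists>c. c * b - 1 \<in> M"
  shows "\<exists>z. a - z *\<^sub>C 1 \<in> M"
proof (rule ccontr)
  assume "\<nexists>z. a - z *\<^sub>C 1 \<in> M"
  then have "\<forall>z. \<exists>c. c * (a - z *\<^sub>C 1) - 1 \<in> M"
    using maximal by blast
  then obtain b where b: "\<And>z. b z * (a - z *\<^sub>C 1) - 1 \<in> M"
    by metis
  define p where "p x = infdist x M" for x
  note I = proper_idealD[OF M]
  have p_add: "p (x + y) \<le> p x + p y" and p_mult: "p (x * y) \<le> p x * p y"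
    and p_scale: "p (c *\<^sub>C x) = cmod c * p x" and p_one: "p 1 > 0" and p_pos: "p x \<ge> 0" for x y c
    unfolding p_def by (rule infdist_ideal[OF M] infdist_nonneg)+
  have p_M: "p x = 0" if "x \<in> M" for x
    using that by (simp add: p_def)
  have p_cong: "p x \<le> p y" if "x - y \<in> M" for x y
    using p_add[of "x - y" y] p_M[OF that] by simp
  obtain l where l: "linear l" "\<And>c x. l (c *\<^sub>C x) = c * l x" "\<And>x. cmod (l x) \<le> 2 * p x"
    and l_one: "Re (l 1) = p 1"
    using complex_hahn_banach[of p 1] p_add p_scale by blast
  have l_cong: "l x = l y" if "x - y \<in> M" for x y
    using l(3)[of "x - y"] p_M[OF that] linear_diff[OF l(1), of x y] by simp
  \<comment> \<open>The resolvent identity modulo \<open>M\<close>: in the difference of two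
    multiples of members of \<open>M\<close> the terms with \<open>b z * b w * a\<close>
    cancel.\<close>
  have resolvent: "(b z - b w) - (z - w) *\<^sub>C (b w * b z) \<in> M" for z w
  proof -
    have "b z * (b w * (a - w *\<^sub>C 1) - 1) - b w * (b z * (a - z *\<^sub>C 1) - 1) \<in> M"
      by (intro I(6) I(3) b)
    also have "b z * (b w * (a - w *\<^sub>C 1) - 1) - b w * (b z * (a - z *\<^sub>C 1) - 1)
        = - ((b z - b w) - (z - w) *\<^sub>C (b w * b z))"
      by (simp add: algebra_simps mult_scaleC_right scaleC_diff_left)
    finally show ?thesis
      using I(5) by (metis minus_minus)
  qed
  have p_diff: "p (b z - b w) \<le> cmod (z - w) * (p (b w) * p (b z))" for z w
    using p_cong[OF resolvent] p_scale p_mult[of "b w" "b z"]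
    by (metis mult_left_mono norm_ge_zero order_trans)
  have deriv: "((\<lambda>z. l (b z)) has_field_derivative l (b w * b w)) (at w)" for w
    unfolding has_field_derivative_iff
  proof (rule LIM_I)
    fix e :: real assume "e > 0"
    define B where "B = p (b w)"
    have "B \<ge> 0" by (simp add: B_def p_pos)
    \<comment> \<open>The first bound gives \<open>cmod (z - w) * B \<le> 1 / 2\<close>, so that
      \<open>p (b z) \<le> B + p (b z) / 2\<close> and thus \<open>p (b z) \<le> 2 * B\<close>. The
      second makes the final error \<open>4 * B * B * B * cmod (z - w)\<close> smaller than
      \<open>e\<close>. The added ones keep the denominators positive when
      \<open>B = 0\<close>.\<close>
    define d where "d = min (1 / (2 * (B + 1))) (e / (4 * B * B * B + 1))"
    have "d > 0" using \<open>B \<ge> 0\<close> \<open>e > 0\<close> by (auto simp: d_def add_nonneg_pos)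
    moreover have "cmod ((l (b z) - l (b w)) / (z - w) - l (b w * b w)) < e"
      if z: "z \<noteq> w" "cmod (z - w) < d" for z
    proof -
      have "cmod (z - w) * B \<le> 1 / 2"
      proof -
        have "cmod (z - w) * B \<le> 1 / (2 * (B + 1)) * B"
          using z \<open>B \<ge> 0\<close> by (intro mult_right_mono) (auto simp: d_def)
        also have "\<dots> \<le> 1 / 2" using \<open>B \<ge> 0\<close> by (simp add: field_simps)
        finally show ?thesis .
      qed
      then have half: "cmod (z - w) * B * p (b z) \<le> 1 / 2 * p (b z)"
        by (rule mult_right_mono) (rule p_pos)
      have "p (b z) \<le> p (b w) + p (b z - b w)"
        using p_add[of "b w" "b z - b w"] by simp
      also have "\<dots> \<le> B + cmod (z - w) * B * p (b z)"
        using p_diff[of z w] by (simp add: B_def mult.assoc)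
      finally have bz: "p (b z) \<le> 2 * B"
        using half by linarith
      have lz: "l (b z) - l (b w) = (z - w) * l (b w * b z)"
        using l_cong[OF resolvent] l(2) linear_diff[OF l(1)] by metis
      have "(l (b z) - l (b w)) / (z - w) - l (b w * b w) = l (b w * (b z - b w))"
        using z by (simp add: lz right_diff_distrib linear_diff[OF l(1)])
      also have "cmod \<dots> \<le> 2 * (p (b w) * p (b z - b w))"
        using l(3)[of "b w * (b z - b w)"] p_mult[of "b w" "b z - b w"] by linarith
      also have "\<dots> \<le> 2 * (B * (cmod (z - w) * (B * (2 * B))))"
        unfolding B_def[symmetric]
        using p_diff[of z w] bz \<open>B \<ge> 0\<close>
        by (intro mult_left_mono order_trans[OF p_diff] mult_mono) (auto simp: B_def p_pos)
      also have "\<dots> = cmod (z - w) * (4 * B * B * B)"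
        by simp
      also have "\<dots> \<le> cmod (z - w) * (4 * B * B * B + 1)"
        by (intro mult_left_mono) auto
      also have "\<dots> < e"
      proof -
        have "4 * B * B * B + 1 > 0"
          using \<open>B \<ge> 0\<close> by (simp add: add_nonneg_pos)
        moreover have "cmod (z - w) < e / (4 * B * B * B + 1)"
          using z by (simp add: d_def)
        ultimately show ?thesis
          by (simp only: pos_less_divide_eq)
      qed
      finally show ?thesis .
    qed
    ultimately show "\<exists>d>0. \<forall>z. z \<noteq> w \<and> norm (z - w) < d \<longrightarrow>
        norm ((l (b z) - l (b w)) / (z - w) - l (b w * b w)) < e"
      by blast
  qed
  have zb: "(z *\<^sub>C b z) - (a * b z - 1) \<in> M" for z
  proof -
    have "(z *\<^sub>C b z) - (a * b z - 1) = - (b z * (a - z *\<^sub>C 1) - 1)"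
      by (simp add: algebra_simps mult_scaleC_right)
    then show ?thesis using I(5)[OF b] by metis
  qed
  have decay: "((\<lambda>z. p (b z)) \<longlongrightarrow> 0) at_infinity"
  proof (rule Lim_null_comparison)
    show "\<forall>\<^sub>F z in at_infinity. norm (p (b z)) \<le> 2 * p 1 * norm (inverse z)"
      unfolding eventually_at_infinity
    proof (intro exI allI impI)
      \<comment> \<open>Here \<open>p a\<close> is at most half of \<open>norm z\<close>, so
        \<open>p a * p (b z)\<close> can be absorbed into \<open>norm z * p (b z)\<close>; the
        summand 1 keeps \<open>z\<close> away from 0.\<close>
      fix z :: complex assume z: "2 * p a + 1 \<le> norm z"
      have "p (- 1) = p 1" using p_scale[of "- 1" 1] by (simp add: scaleC_minus_one)
      then have "norm z * p (b z) \<le> p a * p (b z) + p 1"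
        using p_cong[OF zb[of z]] p_add[of "a * b z" "- 1"] p_mult[of a "b z"]
        by (simp add: p_scale)
      moreover have "2 * p a * p (b z) \<le> norm z * p (b z)"
        using z by (intro mult_right_mono p_pos) auto
      ultimately have "norm z * p (b z) \<le> 2 * p 1"
        by linarith
      moreover have "norm z > 0"
        using z p_pos[of a] by linarith
      ultimately show "norm (p (b z)) \<le> 2 * p 1 * norm (inverse z)"
        using p_pos[of "b z"] by (simp add: norm_divide field_simps)
    qed
    have "((\<lambda>z::complex. 2 * p 1 * norm (inverse z)) \<longlongrightarrow> 2 * p 1 * norm (0::complex)) at_infinity"
      by (intro tendsto_intros tendsto_inverse_0)
    then show "((\<lambda>z::complex. 2 * p 1 * norm (inverse z)) \<longlongrightarrow> 0) at_infinity"
      by simp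
  qed
  have lb: "l (b z) = 0" for z
  proof (rule Liouville_weak[of "\<lambda>z. l (b z)" 0])
    show "(\<lambda>z. l (b z)) holomorphic_on UNIV"
      using deriv by (auto simp: holomorphic_on_open)
    show "((\<lambda>z. l (b z)) \<longlongrightarrow> 0) at_infinity"
    proof (rule Lim_null_comparison)
      show "\<forall>\<^sub>F z in at_infinity. norm (l (b z)) \<le> 2 * p (b z)"
        using l(3) by simp
      show "((\<lambda>z. 2 * p (b z)) \<longlongrightarrow> 0) at_infinity"
        using tendsto_mult_right_zero[OF decay] by simp
    qed
  qed
  \<comment> \<open>\<open>z *\<^sub>C b z\<close> is congruent to \<open>a * b z - 1\<close>, and
    \<open>l\<close> vanishes on it; so the constant \<open>l 1\<close> is bounded by a multiple of
    \<open>p (b z)\<close>, which decays.\<close>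
  have l_eq: "l 1 = l (a * b z)" for z
    using l_cong[OF zb[of z]] linear_diff[OF l(1)] by (simp add: l(2) lb)
  have "((\<lambda>z::complex. l 1) \<longlongrightarrow> 0) at_infinity"
  proof (rule Lim_null_comparison)
    have "norm (l 1) \<le> 2 * p a * p (b z)" for z
      using l(3)[of "a * b z"] p_mult[of a "b z"] by (simp add: l_eq[of z])
    then show "\<forall>\<^sub>F z in at_infinity. norm (l 1) \<le> 2 * p a * p (b z)"
      by simp
    show "((\<lambda>z. 2 * p a * p (b z)) \<longlongrightarrow> 0) at_infinity"
      using tendsto_mult_right_zero[OF decay] by simp
  qed
  then have "l 1 = 0"
    using tendsto_unique[OF trivial_limit_at_infinity tendsto_const] by blast
  then show False
    using l_one p_one by simp
qed

text \<open>\<open>\<phi> a\<close> is the scalar congruent to \<open>a\<close> modulo a maximal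
  ideal. No nonzero multiple of 1 lies in the ideal, so this scalar is unique, and each law follows
  once the expected value is seen to be a residue.\<close>

theorem character_exists: "\<exists>\<phi> :: 'a::comm_complex_banach_algebra_1 \<Rightarrow> complex. is_character \<phi>"
proof -
  obtain M :: "'a set" where M: "proper_ideal M"
    and maximal: "\<And>b. b \<notin> M \<Longrightarrow> \<exists>c. c * b - 1 \<in> M"
    using maximal_ideal_exists by blast
  obtain \<phi> where \<phi>: "\<And>a. a - \<phi> a *\<^sub>C 1 \<in> M"
    using maximal_ideal_residue[OF M maximal] by metis
  note I = proper_idealD[OF M]
  have unique: "\<phi> a = z" if "a - z *\<^sub>C 1 \<in> M" for a z
  proof (rule ccontr)
    assume "\<phi> a \<noteq> z"
    have "(a - z *\<^sub>C 1) - (a - \<phi> a *\<^sub>C 1) \<in> M"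
      using that \<phi> I(6) by blast
    then have "(\<phi> a - z) *\<^sub>C 1 \<in> M"
      by (simp add: scaleC_diff_left)
    then have "inverse (\<phi> a - z) *\<^sub>C (\<phi> a - z) *\<^sub>C 1 \<in> M"
      by (rule proper_ideal_scaleC[OF M])
    then show False
      using \<open>\<phi> a \<noteq> z\<close> I(4) by (simp add: scaleC_scaleC)
  qed
  have "\<phi> (x + y) = \<phi> x + \<phi> y" for x y
    using I(2)[OF \<phi>[of x] \<phi>[of y]] by (intro unique) (simp add: scaleC_add_left algebra_simps)
  moreover have "\<phi> (c *\<^sub>C x) = c * \<phi> x" for c x
    using proper_ideal_scaleC[OF M \<phi>[of x], of c]
    by (intro unique) (simp add: scaleC_diff_right scaleC_scaleC)
  \<comment> \<open>The members \<open>x * (y - \<phi> y *\<^sub>C 1)\<close> and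
    \<open>\<phi> y *\<^sub>C (x - \<phi> x *\<^sub>C 1)\<close> of \<open>M\<close> add up to
    \<open>x * y - (\<phi> x * \<phi> y) *\<^sub>C 1\<close>.\<close>
  moreover have "\<phi> (x * y) = \<phi> x * \<phi> y" for x y
    using I(2)[OF I(3)[OF \<phi>[of y], of x] I(3)[OF \<phi>[of x], of "\<phi> y *\<^sub>C 1"]]
    by (intro unique) (simp add: algebra_simps mult_scaleC_right scaleC_scaleC scaleC_diff_right)
  moreover have "\<phi> 1 = 1"
    by (rule unique) (simp add: I(1))
  ultimately show ?thesis
    unfolding is_character_def by (metis zero_neq_one)
qed

section \<open>Polynomials of finite type\<close>

lemma bounded_clinear_scaleC_fun:
  assumes "bounded_clinear T"
  shows "bounded_clinear (\<lambda>x. c *\<^sub>C T x)"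
proof -
  have "bounded_linear (\<lambda>y :: 'b. c *\<^sub>C y)"
    by (rule bounded_linear_intro[of _ "cmod c"])
      (simp_all add: scaleC_add_right scaleC_scaleR norm_scaleC mult.commute)
  then have "bounded_linear (\<lambda>x. c *\<^sub>C T x)"
    using assms unfolding bounded_clinear_def by (blast intro: bounded_linear_compose)
  moreover have "c *\<^sub>C T (d *\<^sub>C x) = d *\<^sub>C c *\<^sub>C T x" for d x
    using assms by (simp add: bounded_clinear_def scaleC_scaleC mult.commute)
  ultimately show ?thesis
    by (simp add: bounded_clinear_def)
qed

lemma bounded_clinear_add:
  assumes "bounded_clinear S" "bounded_clinear T"
  shows "bounded_clinear (\<lambda>x. S x + T x)"
  using assms by (simp add: bounded_clinear_def bounded_linear_add scaleC_add_right)

lemma bounded_clinear_scaleR_fun: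
  assumes "bounded_clinear T"
  shows "bounded_clinear (\<lambda>x. r *\<^sub>R T x)"
  using bounded_clinear_scaleC_fun[OF assms, of "complex_of_real r"] by (simp add: scaleC_of_real)

lemma bounded_clinear_const_mult:
  assumes "bounded_clinear T"
  shows "bounded_clinear (\<lambda>x. (a::'a::comm_complex_banach_algebra_1) * T x)"
  using assms by (simp add: bounded_clinear_def bounded_linear_const_mult mult_scaleC_right)

lemma bounded_clinear_zero: "bounded_clinear (\<lambda>x. 0)"
  by (simp add: bounded_clinear_def)

lemma bounded_clinear_character:
  assumes \<phi>: "is_character \<phi>" and T: "bounded_clinear T"
  shows "bounded_clinear (\<lambda>x. \<phi> (T x))"
proof -
  have "\<phi> (r *\<^sub>R a) = r *\<^sub>R \<phi> a" for r a
    using \<phi> unfolding is_character_def by (metis scaleC_of_real scaleR_conv_of_real)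
  then have "bounded_linear \<phi>"
    using \<phi> norm_character_le[OF \<phi>]
    by (intro bounded_linear_intro[of _ 1]) (simp_all add: is_character_def)
  then have "bounded_linear (\<lambda>x. \<phi> (T x))"
    using T unfolding bounded_clinear_def by (blast intro: bounded_linear_compose)
  then show ?thesis
    using \<phi> T by (simp add: bounded_clinear_def is_character_def scaleC_complex_def)
qed

lemma bounded_clinear_scaleC_one:
  assumes T: "bounded_clinear T"
  shows "bounded_clinear (\<lambda>x. T x *\<^sub>C (1::'a::comm_complex_banach_algebra_1))"
proof -
  have "bounded_linear (\<lambda>c. c *\<^sub>C (1::'a))"
  proof (rule bounded_linear_intro[of _ "norm (1::'a)"])
    show "(r *\<^sub>R c) *\<^sub>C (1::'a) = r *\<^sub>R c *\<^sub>C 1" for r c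
      by (simp add: scaleR_conv_of_real flip: scaleC_of_real scaleC_scaleC)
  qed (simp_all add: scaleC_add_left norm_scaleC)
  then have "bounded_linear (\<lambda>x. T x *\<^sub>C (1::'a))"
    using T unfolding bounded_clinear_def
    by (blast intro: bounded_linear_compose[where f = "\<lambda>c. c *\<^sub>C (1::'a)"])
  then show ?thesis
    using T by (simp add: bounded_clinear_def scaleC_complex_def scaleC_scaleC)
qed

lemma bounded_clinear_functional_separates:
  fixes x y :: "'e::complex_banach"
  assumes "x \<noteq> y"
  shows "\<exists>T :: 'e \<Rightarrow> complex. bounded_clinear T \<and> T x \<noteq> T y"
proof -
  obtain l :: "'e \<Rightarrow> complex" where l: "linear l" "\<And>c x. l (c *\<^sub>C x) = c * l x"
      "\<And>x. cmod (l x) \<le> 2 * norm x" "Re (l (x - y)) = norm (x - y)"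
    using complex_hahn_banach[of norm "x - y"] norm_triangle_ineq norm_scaleC by blast
  have "bounded_linear l"
    using l(1,3) by (intro bounded_linear_intro[of _ 2])
      (simp_all add: linear_add linear_scale mult.commute)
  then have "bounded_clinear l"
    using l(2) by (simp add: bounded_clinear_def scaleC_complex_def)
  moreover have "l x \<noteq> l y"
    using l(4) linear_diff[OF l(1), of x y] assms by auto
  ultimately show ?thesis by blast
qed

text \<open>The powers carry no coefficients, so partial sums of the series in
  \<open>hom_poly\<close> belong here as they stand; closure under coefficients from the complex
  numbers and from \<open>A\<close> has to be proved.\<close>

inductive_set fin_polys :: "('e::complex_banach \<Rightarrow> 'a::comm_complex_banach_algebra_1) set"
  where
    const: "(\<lambda>x. a) \<in> fin_polys"
  | add_power: "f \<in> fin_polys \<Longrightarrow> bounded_clinear T \<Longrightarrow> (\<lambda>x. f x + T x ^ Suc n) \<in> fin_polys"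

lemma fin_polys_power:
  assumes "bounded_clinear T"
  shows "(\<lambda>x. T x ^ n) \<in> fin_polys"
proof (cases n)
  case 0
  then show ?thesis using fin_polys.const[of 1] by simp
next
  case (Suc m)
  then show ?thesis using fin_polys.add_power[OF fin_polys.const[of 0] assms] by simp
qed

lemma fin_polys_linear: "bounded_clinear T \<Longrightarrow> T \<in> fin_polys"
  using fin_polys_power[of T 1] by simp

lemma fin_polys_add:
  assumes "f \<in> fin_polys" "g \<in> fin_polys"
  shows "(\<lambda>x. f x + g x) \<in> fin_polys"
  using assms(2)
proof induction
  case (const a)
  show ?case
    using assms(1)
  proof induction
    case (const b)
    show ?case by (rule fin_polys.const)
  next
    case (add_power f T n)
    then show ?case
      using fin_polys.add_power[of "\<lambda>x. f x + a" T n] by (simp add: algebra_simps)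
  qed
next
  case (add_power g T n)
  then show ?case
    using fin_polys.add_power[of "\<lambda>x. f x + g x" T n] by (simp add: algebra_simps)
qed

lemma complex_root_exists: "\<exists>w::complex. w ^ Suc n = c"
proof (cases "c = 0")
  case False
  then have "exp (Ln c / of_nat (Suc n)) ^ Suc n = c"
    by (subst exp_divide_power_eq) auto
  then show ?thesis by blast
qed auto

lemma fin_polys_scaleC:
  assumes "f \<in> fin_polys"
  shows "(\<lambda>x. c *\<^sub>C f x) \<in> fin_polys"
  using assms
proof induction
  case (const a)
  show ?case by (rule fin_polys.const)
next
  case (add_power f T n)
  \<comment> \<open>The coefficient moves into the operator as a root of order
    \<open>Suc n\<close>.\<close>
  obtain w where w: "w ^ Suc n = c"
    using complex_root_exists by blast
  have "(\<lambda>x. c *\<^sub>C f x + (w *\<^sub>C T x) ^ Suc n) \<in> fin_polys"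
    by (intro fin_polys.add_power bounded_clinear_scaleC_fun add_power)
  then show ?case
    by (simp only: scaleC_power w scaleC_add_right)
qed

lemma fin_polys_scaleR: "f \<in> fin_polys \<Longrightarrow> (\<lambda>x. r *\<^sub>R f x) \<in> fin_polys"
  using fin_polys_scaleC[of f "complex_of_real r"] by (simp add: scaleC_of_real)

text \<open>Replacing \<open>p t\<close> by \<open>p (2 * t) - 2 ^ m * p t\<close> eliminates the top coefficient.\<close>

lemma coefficient_mem:
  fixes W :: "('b \<Rightarrow> 'c::real_vector) set"
  assumes add: "\<And>f g. f \<in> W \<Longrightarrow> g \<in> W \<Longrightarrow> (\<lambda>x. f x + g x) \<in> W"
    and scale: "\<And>r f. f \<in> W \<Longrightarrow> (\<lambda>x. r *\<^sub>R f x) \<in> W"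
    and W: "\<And>t::real. (\<lambda>x. \<Sum>k\<le>m. t ^ k *\<^sub>R v k x) \<in> W"
    and "k \<le> m"
  shows "v k \<in> W"
  using W \<open>k \<le> m\<close>
proof (induction m arbitrary: v k)
  case 0
  then show ?case using "0.prems"(1)[of 1] by simp
next
  case (Suc m)
  have low: "v k \<in> W" if "k \<le> m" for k
  proof -
    \<comment> \<open>The factor acquired by the \<open>k\<close>-th coefficient: zero for
      \<open>k = Suc m\<close>, nonzero below.\<close>
    let ?c = "\<lambda>k. 2 ^ k - 2 ^ Suc m :: real"
    have "(\<lambda>x. ?c k *\<^sub>R v k x) \<in> W"
    proof (rule Suc.IH[OF _ that])
      fix t :: real
      have "(\<lambda>x. (\<Sum>k\<le>Suc m. (2 * t) ^ k *\<^sub>R v k x) + (- (2 ^ Suc m)) *\<^sub>R (\<Sum>k\<le>Suc m. t ^ k *\<^sub>R v k x)) \<in> W"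
        by (intro add scale Suc.prems)
      also have "(\<lambda>x. (\<Sum>k\<le>Suc m. (2 * t) ^ k *\<^sub>R v k x) + (- (2 ^ Suc m)) *\<^sub>R (\<Sum>k\<le>Suc m. t ^ k *\<^sub>R v k x))
          = (\<lambda>x. \<Sum>k\<le>m. t ^ k *\<^sub>R ?c k *\<^sub>R v k x)"
      proof
        fix x
        have "(\<Sum>k\<le>Suc m. (2 * t) ^ k *\<^sub>R v k x) + (- (2 ^ Suc m)) *\<^sub>R (\<Sum>k\<le>Suc m. t ^ k *\<^sub>R v k x)
            = (\<Sum>k\<le>Suc m. (2 * t) ^ k *\<^sub>R v k x + (- (2 ^ Suc m)) *\<^sub>R t ^ k *\<^sub>R v k x)"
          by (simp only: sum.distrib scaleR_sum_right)
        also have "\<dots> = (\<Sum>k\<le>Suc m. t ^ k *\<^sub>R ?c k *\<^sub>R v k x)"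
          by (intro sum.cong) (simp_all add: power_mult_distrib algebra_simps)
        also have "\<dots> = (\<Sum>k\<le>m. t ^ k *\<^sub>R ?c k *\<^sub>R v k x)"
          by simp
        finally show "(\<Sum>k\<le>Suc m. (2 * t) ^ k *\<^sub>R v k x) + (- (2 ^ Suc m)) *\<^sub>R (\<Sum>k\<le>Suc m. t ^ k *\<^sub>R v k x)
            = (\<Sum>k\<le>m. t ^ k *\<^sub>R ?c k *\<^sub>R v k x)" .
      qed
      finally show "(\<lambda>x. \<Sum>k\<le>m. t ^ k *\<^sub>R ?c k *\<^sub>R v k x) \<in> W" .
    qed
    then have "(\<lambda>x. inverse (?c k) *\<^sub>R ?c k *\<^sub>R v k x) \<in> W"
      by (rule scale)
    moreover have "(2::real) ^ k < 2 ^ Suc m"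
      using that by (intro power_strict_increasing) auto
    then have "?c k \<noteq> 0" by simp
    ultimately show ?thesis by simp
  qed
  have zero: "(\<lambda>x. 0) \<in> W"
    using scale[OF Suc.prems(1)[of 0], of 0] by simp
  have sum: "(\<lambda>x. \<Sum>k<n. v k x) \<in> W" if "n \<le> Suc m" for n
    using that by (induction n) (auto intro: zero add low)
  show ?case
  proof (cases "k \<le> m")
    case True
    then show ?thesis by (rule low)
  next
    case False
    then have k: "k = Suc m" using Suc.prems(2) by simp
    \<comment> \<open>At \<open>t = 1\<close> the polynomial is the sum of all coefficients;
      subtracting the lower ones leaves the top one.\<close>
    have "(\<lambda>x. (\<Sum>k\<le>Suc m. 1 ^ k *\<^sub>R v k x) + (- 1) *\<^sub>R (\<Sum>k<Suc m. v k x)) \<in> W"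
      by (intro add scale Suc.prems(1) sum) simp
    then show ?thesis
      by (simp add: k lessThan_Suc_atMost)
  qed
qed

text \<open>Polarization: \<open>S\<^sup>n T\<close> is, up to a factor, a coefficient of \<open>t \<mapsto> (t T + S)\<^sup>n\<^sup>+\<^sup>1\<close>.\<close>

lemma fin_polys_power_mult_linear:
  assumes "bounded_clinear S" "bounded_clinear T"
  shows "(\<lambda>x. S x ^ n * T x) \<in> fin_polys"
proof -
  define v where "v k x = of_nat (Suc n choose k) * T x ^ k * S x ^ (Suc n - k)" for k x
  have "v 1 \<in> fin_polys"
  proof (rule coefficient_mem[OF fin_polys_add fin_polys_scaleR])
    fix t :: real
    have "(\<lambda>x. (t *\<^sub>R T x + S x) ^ Suc n) \<in> fin_polys"
      by (intro fin_polys_power bounded_clinear_add bounded_clinear_scaleR_fun assms)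
    also have "(\<lambda>x. (t *\<^sub>R T x + S x) ^ Suc n) = (\<lambda>x. \<Sum>k\<le>Suc n. t ^ k *\<^sub>R v k x)"
      unfolding v_def by (subst binomial_ring) (simp add: algebra_scaleR_power del: power_Suc)
    finally show "(\<lambda>x. \<Sum>k\<le>Suc n. t ^ k *\<^sub>R v k x) \<in> fin_polys" .
  qed auto
  then have "(\<lambda>x. (1 / real (Suc n)) *\<^sub>R v 1 x) \<in> fin_polys"
    by (rule fin_polys_scaleR)
  moreover have "v 1 x = real (Suc n) *\<^sub>R (S x ^ n * T x)" for x
    using of_nat_mult_eq_scaleR[of "Suc n" "S x ^ n * T x"]
    by (simp add: v_def ac_simps del: of_nat_Suc)
  ultimately show ?thesis by simp
qed

lemma fin_polys_mult_linear:
  assumes "f \<in> fin_polys" "bounded_clinear T"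
  shows "(\<lambda>x. f x * T x) \<in> fin_polys"
  using assms(1)
proof induction
  case (const a)
  show ?case
    by (intro fin_polys_linear bounded_clinear_const_mult assms)
next
  case (add_power f S n)
  then have "(\<lambda>x. f x * T x + S x ^ Suc n * T x) \<in> fin_polys"
    by (intro fin_polys_add fin_polys_power_mult_linear assms)
  then show ?case by (simp add: algebra_simps)
qed

lemma fin_polys_mult_power:
  assumes "f \<in> fin_polys" "bounded_clinear T"
  shows "(\<lambda>x. f x * T x ^ n) \<in> fin_polys"
proof (induction n)
  case (Suc n)
  then show ?case
    using fin_polys_mult_linear[OF Suc assms(2)] by (simp add: mult.commute mult.left_commute)
qed (simp add: assms)

text \<open>An element of \<open>A\<close> need not have roots, so \<open>a\<close> cannot enter the
  power as a complex factor does. It is attached to one linear factor, and polarization handles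
  \<open>T x ^ n * (a * T x)\<close>.\<close>

lemma fin_polys_mult_const:
  assumes "f \<in> fin_polys"
  shows "(\<lambda>x. f x * a) \<in> fin_polys"
  using assms
proof induction
  case (const b)
  show ?case by (rule fin_polys.const)
next
  case (add_power f T n)
  have "(\<lambda>x. T x ^ n * (a * T x)) \<in> fin_polys"
    using add_power.hyps(2)
    by (intro fin_polys_mult_linear[OF fin_polys_power] bounded_clinear_const_mult)
  with add_power.IH have "(\<lambda>x. f x * a + T x ^ n * (a * T x)) \<in> fin_polys"
    by (rule fin_polys_add)
  then show ?case by (simp add: algebra_simps)
qed

lemma fin_polys_mult:
  assumes "f \<in> fin_polys" "g \<in> fin_polys"
  shows "(\<lambda>x. f x * g x) \<in> fin_polys"
  using assms(2)
proof induction
  case (const a)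
  show ?case by (rule fin_polys_mult_const[OF assms(1)])
next
  case (add_power g T n)
  then have "(\<lambda>x. f x * g x + f x * T x ^ Suc n) \<in> fin_polys"
    by (intro fin_polys_add fin_polys_mult_power assms)
  then show ?case by (simp only: distrib_left)
qed

lemma continuous_on_fin_polys:
  assumes "f \<in> fin_polys"
  shows "continuous_on K f"
  using assms
proof induction
  case (add_power f T n)
  then have "continuous_on K T"
    by (simp add: bounded_clinear_def linear_continuous_on)
  with add_power show ?case
    by (intro continuous_intros)
qed simp

lemma character_comp_fin_polys:
  assumes \<phi>: "is_character \<phi>" and "f \<in> fin_polys"
  shows "(\<lambda>x. \<phi> (f x)) \<in> fin_polys"
  using assms(2)
proof induction
  case (const a)
  show ?case by (rule fin_polys.const)
next
  case (add_power f T n)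
  have "\<phi> (y ^ m) = \<phi> y ^ m" for y m
    using \<phi> character_one[OF \<phi>] by (induction m) (simp_all add: is_character_def)
  then have "(\<lambda>x. \<phi> (f x + T x ^ Suc n)) = (\<lambda>x. \<phi> (f x) + \<phi> (T x) ^ Suc n)"
    using \<phi> by (simp only: is_character_def)
  then show ?case
    using fin_polys.add_power[OF add_power.IH bounded_clinear_character[OF \<phi> add_power.hyps(2)]]
    by simp
qed

lemma scaleC_one_fin_polys:
  assumes "f \<in> fin_polys"
  shows "(\<lambda>x. f x *\<^sub>C (1::'a::comm_complex_banach_algebra_1)) \<in> fin_polys"
  using assms
proof induction
  case (const a)
  show ?case by (rule fin_polys.const)
next
  case (add_power f T n)
  then have "(\<lambda>x. f x *\<^sub>C (1::'a) + (T x *\<^sub>C 1) ^ Suc n) \<in> fin_polys"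
    by (intro fin_polys.add_power bounded_clinear_scaleC_one)
  then show ?case by (simp only: scaleC_power power_one scaleC_add_left)
qed

section \<open>Approximation by polynomials of finite type\<close>

lemma hom_poly_const: "(\<lambda>x. a) \<in> hom_poly 0"
  by (auto simp: hom_poly_def)

lemma zero_hom_poly: "(\<lambda>x. 0) \<in> hom_poly k"
proof (cases "k = 0")
  case True
  then show ?thesis using hom_poly_const by simp
next
  case False
  then show ?thesis
    unfolding hom_poly_def
    by (auto simp: bounded_clinear_zero onorm_zero zero_power intro!: exI[of _ "\<lambda>i x. 0"])
qed

lemma hom_poly_add_power:
  assumes P: "P \<in> hom_poly (Suc n)" and T: "bounded_clinear T"
  shows "(\<lambda>x. P x + T x ^ Suc n) \<in> hom_poly (Suc n)"
proof -
  obtain U where U: "\<And>i. bounded_clinear (U i)" "summable (\<lambda>i. onorm (U i) ^ Suc n)"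
    "\<And>x. (\<lambda>i. U i x ^ Suc n) sums P x"
    using P by (auto simp: hom_poly_def)
  \<comment> \<open>\<open>T\<close> is put in front, so summability and sum reduce to those of the
    tail \<open>U\<close>.\<close>
  define V where "V i = (case i of 0 \<Rightarrow> T | Suc j \<Rightarrow> U j)" for i
  have "bounded_clinear (V i)" for i
    using U(1) T by (simp add: V_def split: nat.split)
  moreover have "summable (\<lambda>i. onorm (V i) ^ Suc n)"
    using U(2) by (subst summable_Suc_iff[symmetric]) (simp add: V_def)
  moreover have "(\<lambda>i. V i x ^ Suc n) sums (P x + T x ^ Suc n)" for x
    using sums_Suc[of "\<lambda>i. V i x ^ Suc n" "P x"] U(3)[of x] by (simp add: V_def)
  ultimately show ?thesis
    unfolding hom_poly_def by auto
qed

lemma polys_add_power: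
  assumes "P \<in> polys" and T: "bounded_clinear T"
  shows "(\<lambda>x. P x + T x ^ Suc n) \<in> polys"
proof -
  obtain m Q where Q: "\<And>k. k \<le> m \<Longrightarrow> Q k \<in> hom_poly k" and P: "P = (\<lambda>x. \<Sum>k\<le>m. Q k x)"
    using assms(1) by (auto simp: polys_def)
  \<comment> \<open>Padding by zero makes room for degree \<open>Suc n\<close>, which may exceed
    \<open>m\<close>.\<close>
  define R where "R k = (if k \<le> m then Q k else (\<lambda>x. 0))" for k
  have R: "R k \<in> hom_poly k" for k
    using Q by (simp add: R_def zero_hom_poly)
  define N where "N = max m (Suc n)"
  define R' where "R' = R(Suc n := (\<lambda>x. R (Suc n) x + T x ^ Suc n))"
  have "R' k \<in> hom_poly k" for k
    using R hom_poly_add_power[OF R T] by (simp add: R'_def)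
  moreover have "P x + T x ^ Suc n = (\<Sum>k\<le>N. R' k x)" for x
  proof -
    have "P x = (\<Sum>k\<le>m. R k x)"
      unfolding P by (intro sum.cong) (auto simp: R_def)
    also have "\<dots> = (\<Sum>k\<le>N. R k x)"
      by (intro sum.mono_neutral_left) (auto simp: N_def R_def)
    moreover have "(\<Sum>k\<le>N. R' k x) = (\<Sum>k\<le>N. R k x + (if k = Suc n then T x ^ Suc n else 0))"
      by (intro sum.cong) (auto simp: R'_def)
    moreover have "Suc n \<le> N" by (simp add: N_def)
    ultimately show ?thesis
      by (simp add: sum.distrib del: power_Suc)
  qed
  ultimately show ?thesis
    unfolding polys_def by (intro CollectI exI[of _ N] exI[of _ R']) auto
qed

lemma fin_polys_subset_polys: "f \<in> fin_polys \<Longrightarrow> f \<in> polys"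
proof (induction rule: fin_polys.induct)
  case (const a)
  show ?case
    unfolding polys_def using hom_poly_const[of a]
    by (intro CollectI exI[of _ 0] exI[of _ "\<lambda>_ _. a"]) auto
qed (rule polys_add_power)

text \<open>Phrased pointwise, without \<open>restrict\<close> or the metric of
  \<open>cont_funs\<close>, so that it applies to functions on all of \<open>'e\<close> and its
  closure properties are plain norm estimates.\<close>

definition fin_approx :: "'e::complex_banach set \<Rightarrow> ('e \<Rightarrow> 'a::comm_complex_banach_algebra_1) \<Rightarrow> bool"
  where "fin_approx K f \<longleftrightarrow> (\<forall>\<epsilon>>0. \<exists>g\<in>fin_polys. \<forall>x\<in>K. norm (f x - g x) < \<epsilon>)"

lemma fin_approx_fin_polys: "f \<in> fin_polys \<Longrightarrow> fin_approx K f"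
  unfolding fin_approx_def by force

lemma fin_approx_closed:
  assumes "\<And>\<epsilon>. \<epsilon> > 0 \<Longrightarrow> \<exists>g. fin_approx K g \<and> (\<forall>x\<in>K. norm (f x - g x) < \<epsilon>)"
  shows "fin_approx K f"
  unfolding fin_approx_def
proof (intro allI impI)
  fix \<epsilon> :: real assume "\<epsilon> > 0"
  then obtain g h where "\<forall>x\<in>K. norm (f x - g x) < \<epsilon> / 2" "h \<in> fin_polys" "\<forall>x\<in>K. norm (g x - h x) < \<epsilon> / 2"
    using assms[of "\<epsilon> / 2"] unfolding fin_approx_def by (meson half_gt_zero)
  then have "\<forall>x\<in>K. norm (f x - h x) < \<epsilon>"
    using norm_diff_triangle_less[of "f _" "g _" "\<epsilon> / 2" "h _" "\<epsilon> / 2"] by fastforce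
  then show "\<exists>h\<in>fin_polys. \<forall>x\<in>K. norm (f x - h x) < \<epsilon>"
    using \<open>h \<in> fin_polys\<close> by blast
qed

lemma fin_approx_add:
  assumes "fin_approx K f" "fin_approx K g"
  shows "fin_approx K (\<lambda>x. f x + g x)"
  unfolding fin_approx_def
proof (intro allI impI)
  fix \<epsilon> :: real assume "\<epsilon> > 0"
  then have "\<epsilon> / 2 > 0" by simp
  with assms obtain f' g' where f'g': "f' \<in> fin_polys" "g' \<in> fin_polys"
    "\<forall>x\<in>K. norm (f x - f' x) < \<epsilon> / 2" "\<forall>x\<in>K. norm (g x - g' x) < \<epsilon> / 2"
    unfolding fin_approx_def by blast
  have "\<forall>x\<in>K. norm (f x + g x - (f' x + g' x)) < \<epsilon>"
  proof
    fix x assume "x \<in> K"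
    then show "norm (f x + g x - (f' x + g' x)) < \<epsilon>"
      using f'g'(3,4) norm_triangle_lt[of "f x - f' x" "g x - g' x" \<epsilon>]
      by (force simp: algebra_simps)
  qed
  then show "\<exists>h\<in>fin_polys. \<forall>x\<in>K. norm (f x + g x - h x) < \<epsilon>"
    using fin_polys_add[OF f'g'(1,2)] by (intro bexI[of _ "\<lambda>x. f' x + g' x"])
qed

lemma fin_approx_scaleC:
  assumes "fin_approx K f"
  shows "fin_approx K (\<lambda>x. c *\<^sub>C f x)"
  unfolding fin_approx_def
proof (intro allI impI)
  fix \<epsilon> :: real assume "\<epsilon> > 0"
  then have "\<epsilon> / (cmod c + 1) > 0" by (simp add: add_nonneg_pos)
  with assms obtain g where g: "g \<in> fin_polys" "\<forall>x\<in>K. norm (f x - g x) < \<epsilon> / (cmod c + 1)"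
    unfolding fin_approx_def by blast
  have "norm (c *\<^sub>C f x - c *\<^sub>C g x) < \<epsilon>" if "x \<in> K" for x
  proof -
    have "norm (f x - g x) * (cmod c + 1) < \<epsilon>"
      using g(2) that by (simp add: pos_less_divide_eq add_nonneg_pos)
    moreover have "norm (c *\<^sub>C f x - c *\<^sub>C g x) \<le> norm (f x - g x) * (cmod c + 1)"
      by (simp add: norm_scaleC algebra_simps flip: scaleC_diff_right)
    ultimately show ?thesis by simp
  qed
  then show "\<exists>h\<in>fin_polys. \<forall>x\<in>K. norm (c *\<^sub>C f x - h x) < \<epsilon>"
    using fin_polys_scaleC[OF g(1)] by (intro bexI[of _ "\<lambda>x. c *\<^sub>C g x"]) auto
qed

lemma fin_approx_mult:
  assumes "fin_approx K f" "fin_approx K g" and bdd: "bounded (f ` K)" "bounded (g ` K)"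
  shows "fin_approx K (\<lambda>x. f x * g x)"
  unfolding fin_approx_def
proof (intro allI impI)
  fix \<epsilon> :: real assume "\<epsilon> > 0"
  obtain B where "B > 0" and B: "\<And>x. x \<in> K \<Longrightarrow> norm (f x) \<le> B" "\<And>x. x \<in> K \<Longrightarrow> norm (g x) \<le> B"
  proof -
    obtain B C where "B > 0" "\<forall>y\<in>f ` K. norm y \<le> B" "\<forall>y\<in>g ` K. norm y \<le> C"
      using bdd bounded_pos by metis
    then show ?thesis
      by (intro that[of "max B C"]) (auto simp: less_max_iff_disj le_max_iff_disj)
  qed
  \<comment> \<open>The error splits into \<open>f * (g - g')\<close> and
    \<open>(f - f') * g'\<close>; with \<open>norm (g' x) \<le> B + 1\<close>, from
    \<open>\<delta> \<le> 1\<close>, it is at most \<open>\<delta> * (2 * B + 1)\<close>, strictly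
    below \<open>\<delta> * (2 * B + 2)\<close>.\<close>
  define \<delta> where "\<delta> = min 1 (\<epsilon> / (2 * B + 2))"
  have "2 * B + 2 > 0" "\<delta> \<le> \<epsilon> / (2 * B + 2)"
    using \<open>B > 0\<close> by (simp_all add: \<delta>_def)
  then have \<delta>: "\<delta> > 0" "\<delta> \<le> 1" "\<delta> * (2 * B + 2) \<le> \<epsilon>"
    using \<open>\<epsilon> > 0\<close> by (simp_all only: pos_le_divide_eq) (simp_all add: \<delta>_def)
  with assms(1,2) obtain f' g' where f'g': "f' \<in> fin_polys" "g' \<in> fin_polys"
    "\<forall>x\<in>K. norm (f x - f' x) < \<delta>" "\<forall>x\<in>K. norm (g x - g' x) < \<delta>"
    unfolding fin_approx_def by blast
  have "\<forall>x\<in>K. norm (f x * g x - f' x * g' x) < \<epsilon>"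
  proof
    fix x assume x: "x \<in> K"
    have "norm (g' x) \<le> norm (g x) + norm (g x - g' x)"
      using norm_triangle_ineq4[of "g x" "g x - g' x"] by simp
    then have g': "norm (g' x) \<le> B + 1"
      using B(2)[OF x] f'g'(4) x \<delta>(2) by fastforce
    have "f x * g x - f' x * g' x = f x * (g x - g' x) + (f x - f' x) * g' x"
      by (simp add: algebra_simps)
    then have "norm (f x * g x - f' x * g' x)
        \<le> norm (f x) * norm (g x - g' x) + norm (f x - f' x) * norm (g' x)"
      by (metis add_mono norm_mult_ineq norm_triangle_le)
    also have "\<dots> \<le> B * \<delta> + \<delta> * (B + 1)"
      using B(1)[OF x] g' f'g'(3,4) x \<delta>(1) \<open>B > 0\<close> by (intro add_mono mult_mono) (auto intro: less_imp_le)
    also have "\<dots> < \<epsilon>"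
      using \<delta> by (simp add: algebra_simps)
    finally show "norm (f x * g x - f' x * g' x) < \<epsilon>" .
  qed
  then show "\<exists>h\<in>fin_polys. \<forall>x\<in>K. norm (f x * g x - h x) < \<epsilon>"
    using fin_polys_mult[OF f'g'(1,2)] by (intro bexI[of _ "\<lambda>x. f' x * g' x"])
qed

lemma fin_approx_hom_poly:
  assumes P: "P \<in> hom_poly n" and K: "bounded K"
  shows "fin_approx K P"
proof (cases n)
  case 0
  then show ?thesis
    using P by (auto simp: hom_poly_def intro!: fin_approx_fin_polys fin_polys.const)
next
  case (Suc m)
  obtain T where T: "\<And>i. bounded_clinear (T i)" "summable (\<lambda>i. onorm (T i) ^ n)"
    "\<And>x. (\<lambda>i. T i x ^ n) sums P x"
    using P Suc by (auto simp: hom_poly_def)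
  obtain B where B: "\<And>x. x \<in> K \<Longrightarrow> norm x \<le> B"
    using K by (auto simp: bounded_iff)
  \<comment> \<open>With \<open>B\<close> bounding the norm on \<open>K\<close>, the terms are
    dominated by \<open>onorm (T i) ^ n * B ^ n\<close>, which is summable by the definition of
    \<open>hom_poly\<close>.\<close>
  have "uniform_limit K (\<lambda>N x. \<Sum>i<N. T i x ^ n) (\<lambda>x. \<Sum>i. T i x ^ n) sequentially"
  proof (rule Weierstrass_m_test)
    fix i x assume x: "x \<in> K"
    have "bounded_linear (T i)" using T(1) by (simp add: bounded_clinear_def)
    then have "norm (T i x) \<le> onorm (T i) * B"
      using onorm[of "T i" x] onorm_pos_le[of "T i"] B[OF x]
      by (meson mult_left_mono order_trans)
    then have "norm (T i x) ^ n \<le> (onorm (T i) * B) ^ n"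
      by (intro power_mono) auto
    then show "norm (T i x ^ n) \<le> onorm (T i) ^ n * B ^ n"
      using norm_power_Suc_le[of "T i x" m] by (simp add: Suc power_mult_distrib del: power_Suc)
  next
    show "summable (\<lambda>i. onorm (T i) ^ n * B ^ n)"
      by (intro summable_mult2 T(2))
  qed
  moreover have "(\<lambda>x. \<Sum>i. T i x ^ n) = P"
    using T(3) by (auto simp: sums_iff)
  ultimately have lim: "uniform_limit K (\<lambda>N x. \<Sum>i<N. T i x ^ n) P sequentially"
    by simp
  have partial: "(\<lambda>x. \<Sum>i<N. T i x ^ n) \<in> fin_polys" for N
    by (induction N) (auto intro!: fin_polys_add fin_polys_power fin_polys.const T(1))
  show ?thesis
    unfolding fin_approx_def
  proof (intro allI impI)
    fix \<epsilon> :: real assume "\<epsilon> > 0"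
    then obtain N where "\<forall>x\<in>K. dist (\<Sum>i<N. T i x ^ n) (P x) < \<epsilon>"
      using uniform_limitD[OF lim] unfolding eventually_sequentially by (meson order_refl)
    then show "\<exists>g\<in>fin_polys. \<forall>x\<in>K. norm (P x - g x) < \<epsilon>"
      by (intro bexI[OF _ partial[of N]]) (simp add: dist_norm norm_minus_commute)
  qed
qed

lemma fin_approx_polys:
  assumes "P \<in> polys" and K: "bounded K"
  shows "fin_approx K P"
proof -
  obtain n Q where Q: "\<And>k. k \<le> n \<Longrightarrow> Q k \<in> hom_poly k" and P: "P = (\<lambda>x. \<Sum>k\<le>n. Q k x)"
    using assms(1) by (auto simp: polys_def)
  have "fin_approx K (\<lambda>x. \<Sum>k<j. Q k x)" if "j \<le> Suc n" for j
    using that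
  proof (induction j)
    case 0
    show ?case by (simp add: fin_approx_fin_polys fin_polys.const)
  next
    case (Suc j)
    then have "fin_approx K (\<lambda>x. (\<Sum>k<j. Q k x) + Q j x)"
      by (intro fin_approx_add fin_approx_hom_poly[OF Q K]) auto
    then show ?case by simp
  qed
  from this[of "Suc n"] show ?thesis
    by (simp add: P lessThan_Suc_atMost)
qed

section \<open>The algebra of polynomials on a compact set\<close>

text \<open>Both kinds of polynomials have the same uniform closure: those in \<open>polys\<close>
  are \<open>fin_approx\<close> since \<open>K\<close> is bounded, and those in
  \<open>fin_polys\<close> are in \<open>polys\<close>. From here on neither suprema nor series
  occur.\<close>

lemma mem_poly_algebra_iff:
  fixes f :: "'e::complex_banach \<Rightarrow> 'a::comm_complex_banach_algebra_1"
  assumes K: "compact K"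
  shows "f \<in> poly_algebra K \<longleftrightarrow> f \<in> mspace (cont_funs K) \<and> fin_approx K f"
proof -
  let ?M = "cont_funs K :: ('e \<Rightarrow> 'a) metric"
  interpret M: Metric_space "mspace ?M" "mdist ?M"
    by (rule Metric_space_mspace_mdist)
  have bdd: "bdd_above ((\<lambda>x. norm (f x - g x)) ` K)" if "f \<in> mspace ?M" "g \<in> mspace ?M" for f g
  proof -
    have "continuous_on K (\<lambda>x. norm (f x - g x))"
      using that by (intro continuous_intros) (simp_all add: mspace_cont_funs[OF K] del: mspace_cfunspace)
    then show ?thesis
      using K by (intro bounded_imp_bdd_above compact_imp_bounded compact_continuous_image)
  qed
  have dist_less: "norm (f x - g x) < \<epsilon>"
    if "f \<in> mspace ?M" "g \<in> mspace ?M" "mdist ?M f g < \<epsilon>" "x \<in> K" for f g \<epsilon> x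
    using that cSUP_upper[OF that(4) bdd[OF that(1,2)]] mdist_cont_funs[OF K that(1,2)]
    by (auto split: if_splits)
  \<comment> \<open>The condition \<open>\<epsilon> \<ge> 0\<close> matters for empty
    \<open>K\<close>, where the distance is 0.\<close>
  have dist_le: "mdist ?M f g \<le> \<epsilon>"
    if "f \<in> mspace ?M" "g \<in> mspace ?M" "\<epsilon> \<ge> 0" "\<And>x. x \<in> K \<Longrightarrow> norm (f x - g x) \<le> \<epsilon>" for f g \<epsilon>
    using that mdist_cont_funs[OF K that(1,2)] by (auto intro: cSUP_least)
  have iff: "f \<in> poly_algebra K \<longleftrightarrow> f \<in> mspace ?M \<and>
      (\<forall>r>0. \<exists>P\<in>polys. restrict P K \<in> mspace ?M \<and> mdist ?M f (restrict P K) < r)"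
    unfolding poly_algebra_def mtopology_of_def M.metric_closure_of
    by (auto simp: M.in_mball simp del: mspace_cfunspace)
  show ?thesis
  proof
    assume f: "f \<in> poly_algebra K"
    have "fin_approx K f"
    proof (rule fin_approx_closed)
      fix \<epsilon> :: real assume "\<epsilon> > 0"
      then obtain P where P: "P \<in> polys" "restrict P K \<in> mspace ?M" "mdist ?M f (restrict P K) < \<epsilon>"
        using f iff by blast
      have "norm (f x - P x) < \<epsilon>" if "x \<in> K" for x
        using dist_less[OF _ P(2,3) that] f iff that by simp
      then show "\<exists>g. fin_approx K g \<and> (\<forall>x\<in>K. norm (f x - g x) < \<epsilon>)"
        using fin_approx_polys[OF P(1) compact_imp_bounded[OF K]] by blast
    qed
    then show "f \<in> mspace ?M \<and> fin_approx K f"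
      using f iff by blast
  next
    assume f: "f \<in> mspace ?M \<and> fin_approx K f"
    have "\<exists>P\<in>polys. restrict P K \<in> mspace ?M \<and> mdist ?M f (restrict P K) < r" if "r > 0" for r
    proof -
      \<comment> \<open>A strict pointwise bound passes to the supremum only as a weak one, hence
        \<open>r / 2\<close>.\<close>
      obtain g where g: "g \<in> fin_polys" "\<And>x. x \<in> K \<Longrightarrow> norm (f x - g x) < r / 2"
        using f \<open>r > 0\<close> unfolding fin_approx_def by (meson half_gt_zero)
      have "continuous_on K (restrict g K)"
        using continuous_on_fin_polys[OF g(1), of K] by (simp cong: continuous_on_cong)
      then have rg: "restrict g K \<in> mspace ?M"
        by (simp add: mspace_cont_funs[OF K] del: mspace_cfunspace)
      have "mdist ?M f (restrict g K) \<le> r / 2"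
        using f g(2) \<open>r > 0\<close> by (intro dist_le rg) (auto intro: less_imp_le)
      then show ?thesis
        using rg fin_polys_subset_polys[OF g(1)] \<open>r > 0\<close> by (intro bexI[of _ g]) auto
    qed
    then show "f \<in> poly_algebra K"
      using f iff by blast
  qed
qed

lemma restrict_mem_poly_algebra:
  assumes K: "compact K" and "continuous_on K f" "fin_approx K f"
  shows "restrict f K \<in> poly_algebra K"
proof -
  have "continuous_on K (restrict f K)"
    using assms(2) by (simp cong: continuous_on_cong)
  moreover have "fin_approx K (restrict f K)"
    using assms(3) by (simp add: fin_approx_def)
  ultimately show ?thesis
    by (simp add: mem_poly_algebra_iff[OF K] mspace_cont_funs[OF K] del: mspace_cfunspace)
qed

lemma poly_algebraD:
  assumes K: "compact K" and "f \<in> poly_algebra K"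
  shows "continuous_on K f" "fin_approx K f" "bounded (f ` K)"
proof -
  show f: "continuous_on K f" and "fin_approx K f"
    using assms(2) by (simp_all add: mem_poly_algebra_iff[OF K] mspace_cont_funs[OF K] del: mspace_cfunspace)
  show "bounded (f ` K)"
    by (intro compact_imp_bounded compact_continuous_image K f)
qed

lemma fin_polys_restrict_mem:
  assumes "compact K" "f \<in> fin_polys"
  shows "restrict f K \<in> poly_algebra K"
  by (intro restrict_mem_poly_algebra fin_approx_fin_polys continuous_on_fin_polys assms)

lemma uniform_algebra_poly_algebra:
  fixes K :: "'e::complex_banach set"
  assumes K: "compact K"
  shows "uniform_algebra K (poly_algebra K :: ('e \<Rightarrow> 'a::comm_complex_banach_algebra_1) set)"
proof -
  let ?P = "poly_algebra K :: ('e \<Rightarrow> 'a) set"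
  note D = poly_algebraD[OF K]
  have const: "(\<lambda>x\<in>K. a) \<in> ?P" for a
    by (intro fin_polys_restrict_mem K fin_polys.const)
  show ?thesis
    unfolding uniform_algebra_def closed_subalgebra_def
  proof (intro conjI ballI allI impI)
    show "closedin (mtopology_of (cont_funs K)) ?P"
      unfolding poly_algebra_def by (rule closedin_closure_of)
    show "(\<lambda>x\<in>K. f x + g x) \<in> ?P" if "f \<in> ?P" "g \<in> ?P" for f g
      by (intro restrict_mem_poly_algebra K continuous_intros fin_approx_add D that)
    show "(\<lambda>x\<in>K. c *\<^sub>C f x) \<in> ?P" if "f \<in> ?P" for c f
    proof -
      \<comment> \<open>Complex scaling is multiplication by \<open>c *\<^sub>C 1\<close>, so
        continuity of products applies.\<close>
      have "continuous_on K (\<lambda>x. (c *\<^sub>C 1) * f x)"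
        by (intro continuous_intros D that)
      then have "continuous_on K (\<lambda>x. c *\<^sub>C f x)"
        by (simp add: scaleC_one_mult)
      then show ?thesis
        by (intro restrict_mem_poly_algebra K fin_approx_scaleC D(2) that)
    qed
    show "(\<lambda>x\<in>K. f x * g x) \<in> ?P" if "f \<in> ?P" "g \<in> ?P" for f g
      by (intro restrict_mem_poly_algebra K continuous_intros fin_approx_mult D that)
    show "\<exists>f\<in>?P. f x \<noteq> f y" if "x \<in> K" "y \<in> K" "x \<noteq> y" for x y
    proof -
      obtain T :: "'e \<Rightarrow> complex" where T: "bounded_clinear T" "T x \<noteq> T y"
        using bounded_clinear_functional_separates[OF \<open>x \<noteq> y\<close>] by blast
      have "(T x - T y) *\<^sub>C (1::'a) \<noteq> 0"
        using T(2) norm_scaleC[of "T x - T y" "1::'a"] by auto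
      then have "T x *\<^sub>C (1::'a) \<noteq> T y *\<^sub>C 1"
        by (simp add: scaleC_diff_left)
      moreover have "(\<lambda>x\<in>K. T x *\<^sub>C (1::'a)) \<in> ?P"
        by (intro fin_polys_restrict_mem K fin_polys_linear bounded_clinear_scaleC_one T)
      ultimately show ?thesis
        using that by (metis restrict_apply')
    qed
  qed (rule const)+
qed

text \<open>As \<open>\<phi>\<close> is 1-Lipschitz, composing an approximant with
  \<open>\<phi>\<close> keeps the tolerance, and the result is again of finite type, now
  scalar.\<close>

lemma character_comp_poly_algebra:
  fixes f :: "'e::complex_banach \<Rightarrow> 'a::comm_complex_banach_algebra_1"
  assumes K: "compact K" and \<phi>: "is_character \<phi>" and f: "f \<in> poly_algebra K"
  shows "(\<lambda>x\<in>K. \<phi> (f x)) \<in> nuclear_poly_algebra K"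
proof (rule restrict_mem_poly_algebra[OF K])
  have lip: "cmod (\<phi> y - \<phi> z) \<le> norm (y - z)" for y z
    using norm_character_le[OF \<phi>, of "y - z"] by (simp add: character_diff[OF \<phi>])
  have "1-lipschitz_on UNIV \<phi>"
    by (rule lipschitz_onI) (simp_all add: dist_norm lip)
  then show "continuous_on K (\<lambda>x. \<phi> (f x))"
    using poly_algebraD(1)[OF K f]
    by (auto intro: continuous_on_compose2[OF lipschitz_on_continuous_on])
  show "fin_approx K (\<lambda>x. \<phi> (f x))"
    unfolding fin_approx_def
  proof (intro allI impI)
    fix \<epsilon> :: real assume "\<epsilon> > 0"
    then obtain g where g: "g \<in> fin_polys" "\<forall>x\<in>K. norm (f x - g x) < \<epsilon>"
      using poly_algebraD(2)[OF K f] unfolding fin_approx_def by blast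
    then show "\<exists>h\<in>fin_polys. \<forall>x\<in>K. norm (\<phi> (f x) - h x) < \<epsilon>"
      using lip by (intro bexI[OF _ character_comp_fin_polys[OF \<phi> g(1)]]) (auto intro: le_less_trans)
  qed
qed

lemma scalar_fun_poly_algebra:
  fixes K :: "'e::complex_banach set"
  assumes K: "compact K" and f: "f \<in> nuclear_poly_algebra K"
  shows "scalar_fun K f \<in> (poly_algebra K :: ('e \<Rightarrow> 'a::comm_complex_banach_algebra_1) set)"
  unfolding scalar_fun_def
proof (rule restrict_mem_poly_algebra[OF K])
  \<comment> \<open>Embedding the scalars multiplies norms by \<open>norm 1\<close>, which need not
    be 1, so tolerances are divided by it.\<close>
  let ?c = "norm (1::'a)"
  have c: "?c > 0" by simp
  have dist: "norm (y *\<^sub>C (1::'a) - z *\<^sub>C 1) = cmod (y - z) * ?c" for y z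
    by (simp add: norm_scaleC flip: scaleC_diff_left)
  have "?c-lipschitz_on UNIV (\<lambda>y. y *\<^sub>C (1::'a))"
    by (rule lipschitz_onI) (simp_all add: dist_norm dist mult.commute)
  then show "continuous_on K (\<lambda>x. f x *\<^sub>C (1::'a))"
    using poly_algebraD(1)[OF K f]
    by (auto intro: continuous_on_compose2[OF lipschitz_on_continuous_on])
  show "fin_approx K (\<lambda>x. f x *\<^sub>C (1::'a))"
    unfolding fin_approx_def
  proof (intro allI impI)
    fix \<epsilon> :: real assume "\<epsilon> > 0"
    then have "\<epsilon> / ?c > 0" by simp
    then obtain g where g: "g \<in> fin_polys" "\<forall>x\<in>K. norm (f x - g x) < \<epsilon> / ?c"
      using poly_algebraD(2)[OF K f] unfolding fin_approx_def by blast
    then show "\<exists>h\<in>fin_polys. \<forall>x\<in>K. norm (f x *\<^sub>C (1::'a) - h x) < \<epsilon>"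
      by (intro bexI[OF _ scaleC_one_fin_polys[OF g(1)]]) (simp add: dist pos_less_divide_eq[OF c])
  qed
qed

theorem theorem2p3:
  fixes K :: "'e::complex_banach set"
  assumes "compact K"
  shows "uniform_algebra K (poly_algebra K :: ('e \<Rightarrow> 'a::comm_complex_banach_algebra_1) set) \<and>
    admissible K (poly_algebra K :: ('e \<Rightarrow> 'a) set) \<and>
    (poly_algebra K :: ('e \<Rightarrow> 'a) set) \<inter> scalar_fun K ` mspace (cont_funs K) =
      scalar_fun K ` nuclear_poly_algebra K"
proof (intro conjI)
  let ?P = "poly_algebra K :: ('e \<Rightarrow> 'a) set"
  show "uniform_algebra K ?P"
    by (rule uniform_algebra_poly_algebra[OF assms])
  show "admissible K ?P"
    unfolding admissible_def
  proof (intro ballI allI impI)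
    fix f and \<phi> :: "'a \<Rightarrow> complex"
    assume "f \<in> ?P" "is_character \<phi>"
    then have "scalar_fun K (\<lambda>x\<in>K. \<phi> (f x)) \<in> ?P"
      by (intro scalar_fun_poly_algebra character_comp_poly_algebra assms)
    also have "scalar_fun K (\<lambda>x\<in>K. \<phi> (f x)) = (scalar_fun K (\<phi> \<circ> f) :: 'e \<Rightarrow> 'a)"
      by (auto simp: scalar_fun_def)
    finally show "scalar_fun K (\<phi> \<circ> f) \<in> ?P" .
  qed
  show "?P \<inter> scalar_fun K ` mspace (cont_funs K) = scalar_fun K ` nuclear_poly_algebra K"
  proof (intro equalityI subsetI)
    fix f assume "f \<in> ?P \<inter> scalar_fun K ` mspace (cont_funs K)"
    then obtain h where f: "f \<in> ?P" "f = scalar_fun K h" and h: "h \<in> mspace (cont_funs K)"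
      by blast
    obtain \<phi> :: "'a \<Rightarrow> complex" where \<phi>: "is_character \<phi>"
      using character_exists by blast
    \<comment> \<open>On \<open>K\<close> the character sends \<open>h x *\<^sub>C 1\<close> back to
      \<open>h x\<close>; off \<open>K\<close> both sides are \<open>undefined\<close>, because
      \<open>h\<close> is extensional.\<close>
    have "(\<lambda>x\<in>K. \<phi> (f x)) = h"
    proof
      show "(\<lambda>x\<in>K. \<phi> (f x)) x = h x" for x
        using h \<phi> character_one[OF \<phi>]
        by (auto simp: f(2) scalar_fun_def is_character_def extensional_def)
    qed
    then show "f \<in> scalar_fun K ` nuclear_poly_algebra K"
      using character_comp_poly_algebra[OF assms \<phi> f(1)] f(2) by blast
  next
    fix f assume "f \<in> (scalar_fun K ` nuclear_poly_algebra K :: ('e \<Rightarrow> 'a) set)"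
    then show "f \<in> ?P \<inter> scalar_fun K ` mspace (cont_funs K)"
      using scalar_fun_poly_algebra[OF assms] mem_poly_algebra_iff[OF assms] by blast
  qed
qed

end
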